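(* Suppose that $q:\mathbb{R}^n\to\overline{\mathbb{R}}$ is prox-regular at $\bar x$ for $\bar x^*\in\partial q(\bar x)$. Further assume that for all $(x,x^* )\in\mathrm{gph}\,\partial q$ sufficiently close to $(\bar x,\bar x^* )$ the function $q$ is subdifferentially continuous at $x$ for $x^*$. Then $$\mathcal{S}^*\partial q(\bar x,\bar x^* )=\mathcal{S}\partial q(\bar x,\bar x^* )=\{\mathrm{gph}\,\partial(\tfrac12\phi)\mid\phi\in\mathrm{quad}\,q(\bar x,\bar x^* )\}.$$
   Context: Norms are Euclidean; $\mathcal{B}_\epsilon(\bar x)$ is the closed ball; $\overline{\mathbb{R}}=\mathbb{R}\cup\{\pm\infty\}$. For a set $A$ and $\bar z\in A$, the tangent cone $T_A(\bar z)$ is the set of all $w$ for which there are $t_k\downarrow0$, $w_k\to w$ with $\bar z+t_kw_k\in A$ for all $k$; $\widehat N_A(\bar z)$ is its (negative) polar cone, and $N_A(\bar z)$ (limiting normal cone) is the set of limits of sequences $z_k^*\in\widehat N_A(z_k)$ with $z_k\to\bar z$, $z_k\in A$. For $q$ finite at $x$, $\partial q(x)=\{x^*\mid(x^*,-1)\in N_{\mathrm{epi}\,q}(x,q(x))\}$ (limiting subdifferential), $\mathrm{epi}\,q=\{(x,\alpha)\in\mathbb{R}^n\times\mathbb{R}\mid\alpha\ge q(x)\}$. $q$ is prox-regular at $\bar x$ for $\bar x^*\in\partial q(\bar x)$ if $q$ is locally lower semicontinuous around $\bar x$ and there are $\epsilon>0$, $\rho\ge0$ such that for all $x',x\in\mathcal{B}_\epsilon(\bar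 x)$ with $|q(x)-q(\bar x)|\le\epsilon$ one has $q(x')\ge q(x)+\langle x^*,x'-x\rangle-\frac\rho2\|x'-x\|^2$ whenever $x^*\in\partial q(x)\cap\mathcal{B}_\epsilon(\bar x^* )$. $q$ is subdifferentially continuous at $x$ for $x^*\in\partial q(x)$ if $q(x_k)\to q(x)$ for every sequence $(x_k,x_k^* )\to(x,x^* )$ in $\mathrm{gph}\,\partial q$. Second-order notions. For $q(x)$ finite and $x^*\in\mathbb{R}^n$, $\Delta_t^2q(x,x^* )(w):=\dfrac{q(x+tw)-q(x)-t\langle x^*,w\rangle}{\frac12t^2}$ for $t>0$, and $\mathrm{d}^2q(x,x^* )(w):=\liminf_{t\downarrow0,\,w'\to w}\Delta_t^2q(x,x^* )(w')$. $q$ is twice epi-differentiable at $x$ for $x^*$ if $\Delta_t^2q(x,x^* )$ epi-converges to $\mathrm{d}^2q(x,x^* )$ as $t\downarrow0$. A function $\phi:\mathbb{R}^n\to\overline{\mathbb{R}}$ is a generalized quadratic form if $\phi(0)=0$ and $\mathrm{gph}\,\partial\phi$ is a linear subspace of $\mathbb{R}^n\times\mathbb{R}^n$. $q$ is generalized twice differentiable at $x$ for $x^*\in\partial q(x)$ if it is twice epi-differentiable at $x$ for $x^*$ and $\mathrm{d}^2q(x,x^* )$ is a generalized quadratic form. The quadratic bundle $\mathrm{quad}\,q(x,x^* )$, $(x,x^* )\in\mathrm{gph}\,\partial q$, is the collection of all generalized quadratic forms $\phi$ for which there is a sequence $(x_k,x_k^* )\to(x,x^* )$ such that $q$ is generalized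 twice differentiable at $x_k$ for $x_k^*$ (with $x_k^*\in\partial q(x_k)$) and $\phi_k=\mathrm{d}^2q(x_k,x_k^* )$ converges epigraphically to $\phi$. Subspace derivatives. $\mathcal{Z}_n$ is the set of $n$-dimensional linear subspaces of $\mathbb{R}^{2n}=\mathbb{R}^n\times\mathbb{R}^n$ with metric $d_{\mathcal{Z}}(L_1,L_2)=\|P_1-P_2\|$, $P_i$ the orthogonal projection onto $L_i$. $L^*:=\{(-v^*,u^* )\mid(u^*,v^* )\in L^\perp\}$. For $F:\mathbb{R}^n\rightrightarrows\mathbb{R}^n$, $\mathcal{O}_F$ is the set of $(x,y)\in\mathrm{gph}\,F$ with $T_{\mathrm{gph}\,F}(x,y)\in\mathcal{Z}_n$; for $(x,y)\in\mathrm{gph}\,F$, $\mathcal{S}F(x,y)$ (resp. $\mathcal{S}^*F(x,y)$) is the set of all $L\in\mathcal{Z}_n$ for which there is a sequence $(x_k,y_k)\to(x,y)$ in $\mathcal{O}_F$ with $d_{\mathcal{Z}}(L,T_{\mathrm{gph}\,F}(x_k,y_k))\to0$ (resp. $d_{\mathcal{Z}}(L,T_{\mathrm{gph}\,F}(x_k,y_k)^* )\to0$). *)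

theory Defs
  imports "HOL-Analysis.Analysis"
begin

section \<open>Tangent and normal cones\<close>

definition tangent_cone :: "'a::euclidean_space set \<Rightarrow> 'a \<Rightarrow> 'a set" where
  "tangent_cone A z =
     {w. \<exists>t w'. (\<forall>k. t k > 0) \<and> t \<longlonglongrightarrow> (0::real) \<and> w' \<longlonglongrightarrow> w \<and>
           (\<forall>k::nat. z + t k *\<^sub>R w' k \<in> A)}"

definition polar_cone :: "'a::euclidean_space set \<Rightarrow> 'a set" where
  "polar_cone K = {v. \<forall>w\<in>K. inner v w \<le> 0}"

definition regular_normal_cone :: "'a::euclidean_space set \<Rightarrow> 'a \<Rightarrow> 'a set" where
  "regular_normal_cone A z = polar_cone (tangent_cone A z)"

definition limiting_normal_cone :: "'a::euclidean_space set \<Rightarrow> 'a \<Rightarrow> 'a set" where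
  "limiting_normal_cone A z =
     {v. \<exists>zs vs. (\<forall>k::nat. zs k \<in> A \<and> vs k \<in> regular_normal_cone A (zs k)) \<and>
           zs \<longlonglongrightarrow> z \<and> vs \<longlonglongrightarrow> v}"


section \<open>Subgradients of extended-real-valued functions\<close>

definition epi :: "('a::euclidean_space \<Rightarrow> ereal) \<Rightarrow> ('a \<times> real) set" where
  "epi q = {(x, \<alpha>). q x \<le> ereal \<alpha>}"

text \<open>The subdifferential is empty wherever \<open>q\<close> is not finite.\<close>

definition subdiff :: "('a::euclidean_space \<Rightarrow> ereal) \<Rightarrow> 'a \<Rightarrow> 'a set" where
  "subdiff q x =
     {v. \<bar>q x\<bar> \<noteq> \<infinity> \<and> (v, -1) \<in> limiting_normal_cone (epi q) (x, real_of_ereal (q x))}"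

definition gph :: "('a \<Rightarrow> 'b set) \<Rightarrow> ('a \<times> 'b) set" where
  "gph F = {(x, y). y \<in> F x}"

text \<open>
  Local lower semicontinuity in the sense of Rockafellar and Wets, Variational Analysis,
  Definition 1.33. It holds in particular if \<open>q\<close> is lower semicontinuous at every point of a
  neighbourhood of \<open>x\<close>.
\<close>

definition locally_lsc :: "('a::euclidean_space \<Rightarrow> ereal) \<Rightarrow> 'a \<Rightarrow> bool" where
  "locally_lsc q x \<longleftrightarrow>
     (\<exists>\<epsilon>>0. \<forall>\<alpha>::real. ereal \<alpha> \<le> q x + ereal \<epsilon> \<longrightarrow> closed {y \<in> cball x \<epsilon>. q y \<le> ereal \<alpha>})"

definition prox_regular :: "('a::euclidean_space \<Rightarrow> ereal) \<Rightarrow> 'a \<Rightarrow> 'a \<Rightarrow> bool" where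
  "prox_regular q xb vb \<longleftrightarrow>
     vb \<in> subdiff q xb \<and> locally_lsc q xb \<and>
     (\<exists>\<epsilon>>0. \<exists>\<rho>\<ge>0. \<forall>x'\<in>cball xb \<epsilon>. \<forall>x\<in>cball xb \<epsilon>. \<bar>q x - q xb\<bar> \<le> ereal \<epsilon> \<longrightarrow>
        (\<forall>v \<in> subdiff q x \<inter> cball vb \<epsilon>.
           q x' \<ge> q x + ereal (inner v (x' - x) - \<rho> / 2 * (norm (x' - x))\<^sup>2)))"

definition subdiff_continuous :: "('a::euclidean_space \<Rightarrow> ereal) \<Rightarrow> 'a \<Rightarrow> 'a \<Rightarrow> bool" where
  "subdiff_continuous q x v \<longleftrightarrow>
     v \<in> subdiff q x \<and>
     (\<forall>xs vs. (\<forall>k::nat. (xs k, vs k) \<in> gph (subdiff q)) \<longrightarrow>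
        (\<lambda>k. (xs k, vs k)) \<longlonglongrightarrow> (x, v) \<longrightarrow> (\<lambda>k. q (xs k)) \<longlonglongrightarrow> q x)"


section \<open>Epi-convergence\<close>

text \<open>
  Painleve-Kuratowski outer and inner limits of a family of sets along a filter. For
  \<open>sequentially\<close> these are the usual limits of a sequence of sets, and for \<open>at_right 0\<close> the
  limits along all sequences of positive numbers tending to 0.
\<close>

definition outer_limit :: "('i \<Rightarrow> 'a::topological_space set) \<Rightarrow> 'i filter \<Rightarrow> 'a set" where
  "outer_limit C F = {z. \<forall>U. open U \<and> z \<in> U \<longrightarrow> (\<exists>\<^sub>F i in F. C i \<inter> U \<noteq> {})}"

definition inner_limit :: "('i \<Rightarrow> 'a::topological_space set) \<Rightarrow> 'i filter \<Rightarrow> 'a set" where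
  "inner_limit C F = {z. \<forall>U. open U \<and> z \<in> U \<longrightarrow> (\<forall>\<^sub>F i in F. C i \<inter> U \<noteq> {})}"

definition epi_converges ::
  "('i \<Rightarrow> 'a::euclidean_space \<Rightarrow> ereal) \<Rightarrow> ('a \<Rightarrow> ereal) \<Rightarrow> 'i filter \<Rightarrow> bool" where
  "epi_converges f \<phi> F \<longleftrightarrow>
     outer_limit (\<lambda>i. epi (f i)) F = epi \<phi> \<and> inner_limit (\<lambda>i. epi (f i)) F = epi \<phi>"


section \<open>Second-order notions\<close>

text \<open>
  The difference quotient and the second subderivative are only meaningful where \<open>q x\<close> is
  finite and for \<open>t > 0\<close>.
\<close>

definition second_quotient ::
  "('a::euclidean_space \<Rightarrow> ereal) \<Rightarrow> 'a \<Rightarrow> 'a \<Rightarrow> real \<Rightarrow> 'a \<Rightarrow> ereal" where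
  "second_quotient q x v t w =
     (q (x + t *\<^sub>R w) - q x - ereal (t * inner v w)) / ereal (1 / 2 * t\<^sup>2)"

definition second_subderiv ::
  "('a::euclidean_space \<Rightarrow> ereal) \<Rightarrow> 'a \<Rightarrow> 'a \<Rightarrow> 'a \<Rightarrow> ereal" where
  "second_subderiv q x v w =
     Liminf (at_right 0 \<times>\<^sub>F nhds w) (\<lambda>(t, w'). second_quotient q x v t w')"

definition twice_epi_differentiable ::
  "('a::euclidean_space \<Rightarrow> ereal) \<Rightarrow> 'a \<Rightarrow> 'a \<Rightarrow> bool" where
  "twice_epi_differentiable q x v \<longleftrightarrow>
     \<bar>q x\<bar> \<noteq> \<infinity> \<and> epi_converges (second_quotient q x v) (second_subderiv q x v) (at_right 0)"

definition generalized_quadratic_form :: "('a::euclidean_space \<Rightarrow> ereal) \<Rightarrow> bool" where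
  "generalized_quadratic_form \<phi> \<longleftrightarrow> \<phi> 0 = 0 \<and> subspace (gph (subdiff \<phi>))"

definition generalized_twice_differentiable ::
  "('a::euclidean_space \<Rightarrow> ereal) \<Rightarrow> 'a \<Rightarrow> 'a \<Rightarrow> bool" where
  "generalized_twice_differentiable q x v \<longleftrightarrow>
     v \<in> subdiff q x \<and> twice_epi_differentiable q x v \<and>
     generalized_quadratic_form (second_subderiv q x v)"

definition quad_bundle ::
  "('a::euclidean_space \<Rightarrow> ereal) \<Rightarrow> 'a \<Rightarrow> 'a \<Rightarrow> ('a \<Rightarrow> ereal) set" where
  "quad_bundle q x v =
     {\<phi>. generalized_quadratic_form \<phi> \<and>
        (\<exists>xs vs. (\<forall>k::nat. generalized_twice_differentiable q (xs k) (vs k)) \<and>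
           (\<lambda>k. (xs k, vs k)) \<longlonglongrightarrow> (x, v) \<and>
           epi_converges (\<lambda>k. second_subderiv q (xs k) (vs k)) \<phi> sequentially)}"


section \<open>Subspace-containing derivatives\<close>

definition Zspaces :: "('a::euclidean_space \<times> 'a) set set" where
  "Zspaces = {L. subspace L \<and> dim L = DIM('a)}"

definition orth_proj :: "'a::euclidean_space set \<Rightarrow> 'a \<Rightarrow> 'a" where
  "orth_proj L z = (THE p. p \<in> L \<and> z - p \<in> orthogonal_comp L)"

definition dist_Z :: "('a::euclidean_space \<times> 'a) set \<Rightarrow> ('a \<times> 'a) set \<Rightarrow> real" where
  "dist_Z L1 L2 = onorm (\<lambda>z. orth_proj L1 z - orth_proj L2 z)"

definition adjoint_subspace :: "('a::euclidean_space \<times> 'a) set \<Rightarrow> ('a \<times> 'a) set" where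
  "adjoint_subspace L = {(- v, u) | u v. (u, v) \<in> orthogonal_comp L}"

definition smooth_points :: "('a::euclidean_space \<Rightarrow> 'a set) \<Rightarrow> ('a \<times> 'a) set" where
  "smooth_points F = {p \<in> gph F. tangent_cone (gph F) p \<in> Zspaces}"

definition subspace_deriv ::
  "('a::euclidean_space \<Rightarrow> 'a set) \<Rightarrow> 'a \<Rightarrow> 'a \<Rightarrow> ('a \<times> 'a) set set" where
  "subspace_deriv F x y =
     {L \<in> Zspaces. \<exists>p. (\<forall>k::nat. p k \<in> smooth_points F) \<and> p \<longlonglongrightarrow> (x, y) \<and>
        (\<lambda>k. dist_Z L (tangent_cone (gph F) (p k))) \<longlonglongrightarrow> 0}"

definition adjoint_subspace_deriv ::
  "('a::euclidean_space \<Rightarrow> 'a set) \<Rightarrow> 'a \<Rightarrow> 'a \<Rightarrow> ('a \<times> 'a) set set" where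
  "adjoint_subspace_deriv F x y =
     {L \<in> Zspaces. \<exists>p. (\<forall>k::nat. p k \<in> smooth_points F) \<and> p \<longlonglongrightarrow> (x, y) \<and>
        (\<lambda>k. dist_Z L (adjoint_subspace (tangent_cone (gph F) (p k)))) \<longlonglongrightarrow> 0}"

end

theory Submission
  imports Defs
begin

text \<open>
  Prox-regularity with constant \<open>\<rho>\<close> and subdifferential continuity make \<open>x\<close> a firmly nonexpansive
  function \<open>P\<close> of \<open>z = r x + v\<close>, \<open>r = \<rho> + 1\<close>, along the subgradient graph near the reference pair, and
  \<open>P\<close> is the gradient of a convex function \<open>f\<close>. The tangent cone at \<open>(x, v)\<close> is an \<open>n\<close>-dimensional
  subspace iff \<open>P\<close> is differentiable at \<open>z\<close>; the derivative \<open>A\<close> is then self-adjoint and the tangent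
  space is \<open>{(A h, h - r A h)}\<close>, which is its own adjoint subspace. The second-order expansion of \<open>f\<close>
  and Fenchel's inequality give twice epi-differentiability of \<open>q\<close>, the second subderivative being the
  form with value \<open>\<langle>A h, h\<rangle> - r |A h|\<^sup>2\<close> at \<open>A h\<close>. Conversely, if \<open>q\<close> is generalized twice
  differentiable with second subderivative \<open>\<phi>\<close>, every cluster point \<open>w\<close> of the difference quotients of
  \<open>P\<close> in direction \<open>h\<close> minimizes \<open>\<phi> + r |\<cdot>|\<^sup>2 - 2 \<langle>h, \<cdot>\<rangle>\<close>, so \<open>(w, 2 (h - r w))\<close> lies in the graph of
  \<open>\<partial>\<phi>\<close>. As \<open>\<phi>\<close> is positively homogeneous of degree 2 and bounded below by \<open>- \<rho> |\<cdot>|\<^sup>2\<close>, such \<open>w\<close> is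
  unique, and \<open>P\<close> is differentiable. The limits are matched by compactness of the set of operators \<open>A\<close>.
\<close>

section \<open>Epi-limits, tangents and second-order quotients\<close>

lemma epi_iff: "(x, \<alpha>) \<in> epi q \<longleftrightarrow> q x \<le> ereal \<alpha>"
  by (simp add: epi_def)

lemma epi_inject:
  assumes "epi \<phi> = epi \<psi>"
  shows "\<phi> = \<psi>"
proof
  fix w
  have "\<phi> w \<le> ereal \<alpha> \<longleftrightarrow> \<psi> w \<le> ereal \<alpha>" for \<alpha>
    using assms epi_iff by (metis epi_iff)
  then show "\<phi> w = \<psi> w"
    by (meson antisym ereal_le_real)
qed

lemma epi_converges_unique:
  "epi_converges f \<phi> F \<Longrightarrow> epi_converges f \<psi> F \<Longrightarrow> \<phi> = \<psi>"
  unfolding epi_converges_def by (intro epi_inject) simp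

text \<open>Passing to \<open>s\<close> along \<open>G\<close> can only enlarge the inner limit and
  shrink the outer one; since \<open>G\<close> is nontrivial the inner limit still lies in the outer
  one, so both are squeezed to \<open>epi \<phi>\<close>.\<close>

lemma epi_converges_compose:
  assumes conv: "epi_converges f \<phi> F" and s: "filterlim s F G" and G: "G \<noteq> bot"
  shows "epi_converges (\<lambda>i. f (s i)) \<phi> G"
proof -
  have ev: "\<forall>\<^sub>F i in G. Q (s i)" if "\<forall>\<^sub>F i in F. Q i" for Q
    using s that by (auto simp: filterlim_iff)
  have "inner_limit (\<lambda>i. epi (f i)) F \<subseteq> inner_limit (\<lambda>i. epi (f (s i))) G"
    unfolding inner_limit_def using ev by blast
  moreover have "outer_limit (\<lambda>i. epi (f (s i))) G \<subseteq> outer_limit (\<lambda>i. epi (f i)) F"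
    unfolding outer_limit_def frequently_def using ev[of "\<lambda>i. \<not> epi (f i) \<inter> _ \<noteq> {}"] by blast
  moreover have "inner_limit (\<lambda>i. epi (f (s i))) G \<subseteq> outer_limit (\<lambda>i. epi (f (s i))) G"
    using eventually_frequently[OF G] unfolding inner_limit_def outer_limit_def by blast
  ultimately show ?thesis
    using conv unfolding epi_converges_def by blast
qed

lemma outer_limit_seqI:
  assumes "filterlim s F sequentially" "y \<longlonglongrightarrow> z" "\<forall>\<^sub>F k in sequentially. y k \<in> C (s k)"
  shows "z \<in> outer_limit C F"
  unfolding outer_limit_def
proof (intro CollectI allI impI)
  fix U assume U: "open U \<and> z \<in> U"
  have "\<forall>\<^sub>F k in sequentially. y k \<in> U"
    using U assms(2) topological_tendstoD by blast
  with assms(3) have ev: "\<forall>\<^sub>F k in sequentially. C (s k) \<inter> U \<noteq> {}"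
    by eventually_elim auto
  show "\<exists>\<^sub>F i in F. C i \<inter> U \<noteq> {}"
    unfolding frequently_def
  proof
    assume "\<forall>\<^sub>F i in F. \<not> C i \<inter> U \<noteq> {}"
    then have "\<forall>\<^sub>F k in sequentially. \<not> C (s k) \<inter> U \<noteq> {}"
      using assms(1) by (auto simp: filterlim_iff)
    with ev have "\<forall>\<^sub>F k::nat in sequentially. False"
      by eventually_elim auto
    then show False by simp
  qed
qed

lemma inner_limit_seqE:
  fixes C :: "'i \<Rightarrow> 'a::metric_space set"
  assumes "z \<in> inner_limit C F" "filterlim s F sequentially"
  obtains y where "y \<longlonglongrightarrow> z" "\<forall>\<^sub>F k in sequentially. y k \<in> C (s k)"
proof -
  have near: "\<forall>\<^sub>F k in sequentially. C (s k) \<inter> ball z e \<noteq> {}" if "e > 0" for e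
  proof -
    have "\<forall>\<^sub>F i in F. C i \<inter> ball z e \<noteq> {}"
      using assms(1) that unfolding inner_limit_def by auto
    then show ?thesis
      using assms(2) by (auto simp: filterlim_iff)
  qed
  \<comment> \<open>The sets need not be closed, so a nearest point may not exist; a point within
    \<open>1 / (k + 1)\<close> of the infimal distance serves instead.\<close>
  have "\<exists>y. C (s k) \<noteq> {} \<longrightarrow> y \<in> C (s k) \<and> dist z y < infdist z (C (s k)) + inverse (real (Suc k))" for k
  proof (cases "C (s k) = {}")
    case False
    have "\<exists>y\<in>C (s k). dist z y < infdist z (C (s k)) + inverse (real (Suc k))"
      using cInf_lessD[of "dist z ` C (s k)" "infdist z (C (s k)) + inverse (real (Suc k))"] False
      by (auto simp: infdist_notempty)
    then show ?thesis by blast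
  qed auto
  then obtain y where y: "\<And>k. C (s k) \<noteq> {} \<Longrightarrow> y k \<in> C (s k) \<and>
      dist z (y k) < infdist z (C (s k)) + inverse (real (Suc k))"
    by metis
  have "y \<longlonglongrightarrow> z"
    unfolding tendsto_iff
  proof (intro allI impI)
    fix e :: real assume "e > 0"
    have "\<forall>\<^sub>F k in sequentially. inverse (real (Suc k)) < e/2"
      using LIMSEQ_inverse_real_of_nat \<open>e > 0\<close> by (intro order_tendstoD(2)) auto
    moreover have "\<forall>\<^sub>F k in sequentially. C (s k) \<inter> ball z (e/2) \<noteq> {}"
      using near[of "e/2"] \<open>e > 0\<close> by simp
    ultimately show "\<forall>\<^sub>F k in sequentially. dist (y k) z < e"
    proof eventually_elim
      case (elim k)
      then obtain a where a: "a \<in> C (s k)" "dist z a < e/2" by auto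
      then have "infdist z (C (s k)) < e/2"
        using infdist_le[OF a(1), of z] by linarith
      then show ?case
        using y[of k] a elim by (force simp: dist_commute)
    qed
  qed
  moreover have "\<forall>\<^sub>F k in sequentially. y k \<in> C (s k)"
    using near[OF zero_less_one] by eventually_elim (use y in auto)
  ultimately show thesis using that by blast
qed

section \<open>Tangent vectors and proximal normals\<close>

lemma polar_tangent_line:
  assumes "v \<in> regular_normal_cone A z" "w \<in> tangent_cone A z" "- w \<in> tangent_cone A z"
  shows "inner v w = 0"
proof -
  have "inner v w \<le> 0" "inner v (- w) \<le> 0"
    using assms unfolding regular_normal_cone_def polar_cone_def by blast+
  then show ?thesis by (simp add: inner_minus_right)
qed

lemma at_right_seq:
  assumes "\<And>k::nat. t k > (0::real)" "t \<longlonglongrightarrow> 0"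
  shows "filterlim t (at_right 0) sequentially"
proof -
  have "t k \<noteq> 0" for k using assms(1)[of k] by simp
  then show ?thesis using assms by (auto simp: filterlim_at)
qed

lemma tangent_cone_seqI:
  assumes "\<And>k::nat. t k > 0" "t \<longlonglongrightarrow> 0" "w' \<longlonglongrightarrow> w" "\<forall>\<^sub>F k in sequentially. z + t k *\<^sub>R w' k \<in> A"
  shows "w \<in> tangent_cone A z"
proof -
  obtain K where "\<And>k. k \<ge> K \<Longrightarrow> z + t k *\<^sub>R w' k \<in> A"
    using assms(4) by (auto simp: eventually_sequentially)
  then show ?thesis
    unfolding tangent_cone_def using assms(1) LIMSEQ_ignore_initial_segment[OF assms(2), of K]
      LIMSEQ_ignore_initial_segment[OF assms(3), of K]
    by (intro CollectI exI[of _ "\<lambda>k. t (k + K)"] exI[of _ "\<lambda>k. w' (k + K)"]) auto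
qed

lemma tangent_coneI:
  assumes "(\<gamma> \<longlongrightarrow> w) (at_right 0)" "\<forall>\<^sub>F t in at_right 0. z + t *\<^sub>R \<gamma> t \<in> A"
  shows "w \<in> tangent_cone A z"
proof -
  define t where "t = (\<lambda>k. inverse (real (Suc k)))"
  have t: "\<And>k. t k > 0" "t \<longlonglongrightarrow> 0"
    using LIMSEQ_inverse_real_of_nat by (auto simp: t_def)
  have "\<forall>\<^sub>F k in sequentially. z + t k *\<^sub>R \<gamma> (t k) \<in> A"
    using at_right_seq[OF t] assms(2) by (auto simp: filterlim_iff)
  then show ?thesis
    by (rule tangent_cone_seqI[OF t filterlim_compose[OF assms(1) at_right_seq[OF t]]])
qed

text \<open>Along tangent directions the quadratic term of the minorant is of second order in
  \<open>t\<close> and drops out after division by \<open>t\<close>. So \<open>(v, -1)\<close> is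
  already a regular normal at the point itself, and constant sequences make it a limiting
  one.\<close>

lemma proximal_subgradient:
  assumes fin: "\<bar>q x\<bar> \<noteq> \<infinity>" and "open U" "x \<in> U"
    and le: "\<And>y. y \<in> U \<Longrightarrow> q x + ereal (inner v (y - x) - c * (norm (y - x))\<^sup>2) \<le> q y"
  shows "v \<in> subdiff q x"
proof -
  obtain \<mu> where \<mu>: "q x = ereal \<mu>" using fin by auto
  have "(v, -1) \<in> regular_normal_cone (epi q) (x, \<mu>)"
    unfolding regular_normal_cone_def polar_cone_def
  proof (intro CollectI ballI)
    fix w assume "w \<in> tangent_cone (epi q) (x, \<mu>)"
    then obtain t w' where t: "\<And>k. t k > 0" "t \<longlonglongrightarrow> 0" "w' \<longlonglongrightarrow> w"
      and mem: "\<And>k. (x, \<mu>) + t k *\<^sub>R w' k \<in> epi q"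
      unfolding tangent_cone_def by blast
    have "(\<lambda>k. x + t k *\<^sub>R fst (w' k)) \<longlonglongrightarrow> x + 0 *\<^sub>R fst w"
      using t by (intro tendsto_intros)
    then have ev: "\<forall>\<^sub>F k in sequentially. x + t k *\<^sub>R fst (w' k) \<in> U"
      using assms(2,3) topological_tendstoD by fastforce
    have "\<forall>\<^sub>F k in sequentially.
        inner v (fst (w' k)) - c * t k * (norm (fst (w' k)))\<^sup>2 \<le> snd (w' k)"
      using ev
    proof eventually_elim
      case (elim k)
      have "q (x + t k *\<^sub>R fst (w' k)) \<le> ereal (\<mu> + t k * snd (w' k))"
        using mem[of k] by (simp add: epi_def case_prod_beta)
      from order_trans[OF le[OF elim] this]
      have "t k * inner v (fst (w' k)) - c * (t k * norm (fst (w' k)))\<^sup>2 \<le> t k * snd (w' k)"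
        using t(1)[of k] by (simp add: \<mu>)
      then have "t k * (inner v (fst (w' k)) - c * t k * (norm (fst (w' k)))\<^sup>2) \<le> t k * snd (w' k)"
        by (simp add: algebra_simps power2_eq_square)
      then show ?case
        using t(1)[of k] by (simp only: mult_le_cancel_left_pos)
    qed
    moreover have "(\<lambda>k. inner v (fst (w' k)) - c * t k * (norm (fst (w' k)))\<^sup>2)
        \<longlonglongrightarrow> inner v (fst w) - c * 0 * (norm (fst w))\<^sup>2"
      using t by (intro tendsto_intros)
    moreover have "(\<lambda>k. snd (w' k)) \<longlonglongrightarrow> snd w"
      using t by (intro tendsto_intros)
    ultimately have "inner v (fst w) - c * 0 * (norm (fst w))\<^sup>2 \<le> snd w"
      by (intro tendsto_le[OF sequentially_bot]) auto
    then show "inner (v, -1) w \<le> 0"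
      by (cases w) simp
  qed
  moreover have "(x, \<mu>) \<in> epi q" using \<mu> by (simp add: epi_def)
  ultimately have "(v, -1) \<in> limiting_normal_cone (epi q) (x, \<mu>)"
    unfolding limiting_normal_cone_def
    by (intro CollectI exI[of _ "\<lambda>_. (x, \<mu>)"] exI[of _ "\<lambda>_. (v, -1)"]) auto
  then show ?thesis using \<mu> by (simp add: subdiff_def)
qed

section \<open>Second-order difference quotients\<close>

lemma second_quotient_le_iff:
  assumes "q x = ereal \<mu>" "t > 0"
  shows "second_quotient q x v t w \<le> ereal \<alpha> \<longleftrightarrow>
    q (x + t *\<^sub>R w) \<le> ereal (\<mu> + t * inner v w + 1 / 2 * t\<^sup>2 * \<alpha>)"
proof (cases "q (x + t *\<^sub>R w)")
  case (real \<beta>)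
  have "t\<^sup>2 > 0" using assms by simp
  then have "(\<beta> - \<mu> - t * inner v w) / (1 / 2 * t\<^sup>2) \<le> \<alpha> \<longleftrightarrow> \<beta> \<le> \<mu> + t * inner v w + 1 / 2 * t\<^sup>2 * \<alpha>"
    by (simp add: field_simps)
  then show ?thesis
    using assms real by (simp add: second_quotient_def)
next
  case PInf
  then show ?thesis using assms by (simp add: second_quotient_def)
next
  case MInf
  then show ?thesis using assms by (simp add: second_quotient_def)
qed

text \<open>The joint liminf in \<open>(t, w')\<close> is what the outer limit of epigraphs
  computes, so in twice epi-differentiability only the inner limit carries information. The lemma
  also identifies \<open>second_subderiv\<close> once an epi-limit of the quotients is
  known.\<close>

lemma epi_second_subderiv:
  "outer_limit (\<lambda>t. epi (second_quotient q x v t)) (at_right 0) = epi (second_subderiv q x v)"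
    (is "?L = ?R")
proof (intro set_eqI iffI)
  fix z assume z: "z \<in> ?L"
  obtain w \<alpha> where zw: "z = (w, \<alpha>)" by (cases z)
  have "second_subderiv q x v w \<le> ereal \<alpha>"
  proof (rule ccontr)
    assume "\<not> ?thesis"
    then obtain y where y: "\<alpha> < y" "ereal y < second_subderiv q x v w"
      using ereal_dense2 by (metis less_ereal.simps(1) not_le)
    then have "\<forall>\<^sub>F (t, w') in at_right 0 \<times>\<^sub>F nhds w. ereal y < second_quotient q x v t w'"
      unfolding second_subderiv_def by (auto dest!: less_LiminfD simp: case_prod_beta')
    then obtain Pf Pg where Pf: "eventually Pf (at_right 0)" and Pg: "eventually Pg (nhds w)"
      and lt: "\<And>t w'. Pf t \<Longrightarrow> Pg w' \<Longrightarrow> ereal y < second_quotient q x v t w'"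
      unfolding eventually_prod_filter by auto
    obtain V where V: "open V" "w \<in> V" "\<And>w'. w' \<in> V \<Longrightarrow> Pg w'"
      using Pg by (auto simp: eventually_nhds)
    have "\<exists>\<^sub>F t in at_right 0. epi (second_quotient q x v t) \<inter> (V \<times> {..<y}) \<noteq> {}"
      using z V y zw unfolding outer_limit_def by (auto simp: open_Times)
    with Pf have "\<exists>\<^sub>F t in at_right 0. epi (second_quotient q x v t) \<inter> (V \<times> {..<y}) \<noteq> {} \<and> Pf t"
      by (rule frequently_eventually_frequently[rotated])
    then obtain t where "epi (second_quotient q x v t) \<inter> (V \<times> {..<y}) \<noteq> {}" "Pf t"
      using frequently_ex by blast
    then obtain w' \<beta> where "second_quotient q x v t w' \<le> ereal \<beta>" "w' \<in> V" "\<beta> < y"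
      by (auto simp: epi_def)
    moreover from lt[OF \<open>Pf t\<close> V(3)[OF this(2)]] have "ereal y < second_quotient q x v t w'" .
    ultimately have "ereal y < ereal \<beta>" by (meson order_less_le_trans)
    with \<open>\<beta> < y\<close> show False by simp
  qed
  then show "z \<in> ?R" by (simp add: zw epi_def)
next
  fix z assume z: "z \<in> ?R"
  obtain w \<alpha> where zw: "z = (w, \<alpha>)" by (cases z)
  show "z \<in> ?L"
    unfolding outer_limit_def
  proof (intro CollectI allI impI)
    fix U assume U: "open U \<and> z \<in> U"
    then obtain V I where VI: "open V" "open I" "w \<in> V" "\<alpha> \<in> I" "V \<times> I \<subseteq> U"
      unfolding open_prod_def zw by (metis mem_Sigma_iff)
    obtain d where d: "d > 0" "ball \<alpha> d \<subseteq> I" using VI open_contains_ball by blast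
    have aI: "\<alpha> + d/2 \<in> I" using d by (auto simp: dist_real_def)
    show "\<exists>\<^sub>F t in at_right 0. epi (second_quotient q x v t) \<inter> U \<noteq> {}"
      unfolding frequently_def
    proof
      assume ev: "\<forall>\<^sub>F t in at_right 0. \<not> epi (second_quotient q x v t) \<inter> U \<noteq> {}"
      have "\<forall>\<^sub>F (t, w') in at_right 0 \<times>\<^sub>F nhds w. ereal (\<alpha> + d/2) \<le> second_quotient q x v t w'"
        unfolding eventually_prod_filter
      proof (intro exI conjI allI impI)
        show "\<forall>\<^sub>F t in at_right 0. \<not> epi (second_quotient q x v t) \<inter> U \<noteq> {}" by fact
        show "\<forall>\<^sub>F w' in nhds w. w' \<in> V" using VI by (simp add: eventually_nhds) blast
        fix t w' assume "\<not> epi (second_quotient q x v t) \<inter> U \<noteq> {}" "w' \<in> V"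
        moreover have "(w', \<alpha> + d/2) \<in> U" using \<open>w' \<in> V\<close> aI VI(5) by auto
        ultimately have "\<not> second_quotient q x v t w' \<le> ereal (\<alpha> + d/2)"
          by (auto simp: epi_iff[symmetric])
        then show "case (t, w') of (t, w') \<Rightarrow> ereal (\<alpha> + d/2) \<le> second_quotient q x v t w'" by simp
      qed
      then have "ereal (\<alpha> + d/2) \<le> second_subderiv q x v w"
        unfolding second_subderiv_def by (intro Liminf_bounded) (simp add: case_prod_beta')
      also have "\<dots> \<le> ereal \<alpha>" using z by (simp add: zw epi_def)
      finally show False using d by simp
    qed
  qed
qed

text \<open>Substitute \<open>t / s\<close> for \<open>t\<close>: the quotient at
  \<open>s *\<^sub>R w\<close> with step \<open>t / s\<close> is \<open>s^2\<close> times the one at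
  \<open>w\<close> with step \<open>t\<close>, and small steps stay small. Working with epigraphs
  avoids products with infinite values.\<close>

lemma second_subderiv_homogeneous:
  assumes fin: "\<bar>q x\<bar> \<noteq> \<infinity>" and "s > 0" and mem: "(w, \<alpha>) \<in> epi (second_subderiv q x v)"
  shows "(s *\<^sub>R w, s\<^sup>2 * \<alpha>) \<in> epi (second_subderiv q x v)"
proof -
  obtain \<mu> where \<mu>: "q x = ereal \<mu>" using fin by auto
  have mem': "(w, \<alpha>) \<in> outer_limit (\<lambda>t. epi (second_quotient q x v t)) (at_right 0)"
    using mem by (simp add: epi_second_subderiv)
  have "(s *\<^sub>R w, s\<^sup>2 * \<alpha>) \<in> outer_limit (\<lambda>t. epi (second_quotient q x v t)) (at_right 0)"
    unfolding outer_limit_def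
  proof (intro CollectI allI impI)
    fix U :: "('a \<times> real) set" assume U: "open U \<and> (s *\<^sub>R w, s\<^sup>2 * \<alpha>) \<in> U"
    define D where "D = (\<lambda>z::'a \<times> real. (s *\<^sub>R fst z, s\<^sup>2 * snd z))"
    have "open (D -` U)"
      unfolding D_def using U by (intro open_vimage continuous_intros) auto
    moreover have "(w, \<alpha>) \<in> D -` U" using U by (simp add: D_def)
    ultimately have fr: "\<exists>\<^sub>F t in at_right 0. epi (second_quotient q x v t) \<inter> (D -` U) \<noteq> {}"
      using mem' unfolding outer_limit_def by blast
    show "\<exists>\<^sub>F t in at_right 0. epi (second_quotient q x v t) \<inter> U \<noteq> {}"
      unfolding frequently_def
    proof
      assume "\<forall>\<^sub>F t in at_right 0. \<not> epi (second_quotient q x v t) \<inter> U \<noteq> {}"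
      then obtain b where b: "b > 0" "\<And>t. 0 < t \<Longrightarrow> t < b \<Longrightarrow> epi (second_quotient q x v t) \<inter> U = {}"
        by (auto simp: eventually_at_right_field)
      have "\<forall>\<^sub>F t in at_right 0. epi (second_quotient q x v t) \<inter> (D -` U) = {}"
        unfolding eventually_at_right_field
      proof (intro exI conjI allI impI)
        show "0 < s * b" using b assms by simp
        fix t :: real assume t: "0 < t" "t < s * b"
        then have t': "0 < t / s" "t / s < b" using assms by (auto simp: field_simps)
        show "epi (second_quotient q x v t) \<inter> D -` U = {}"
        proof (rule ccontr)
          assume "\<not> ?thesis"
          then obtain w' \<beta> where w': "second_quotient q x v t w' \<le> ereal \<beta>" "(s *\<^sub>R w', s\<^sup>2 * \<beta>) \<in> U"
            by (auto simp: epi_def D_def)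
          have "q (x + t *\<^sub>R w') \<le> ereal (\<mu> + t * inner v w' + 1 / 2 * t\<^sup>2 * \<beta>)"
            using w'(1) t by (simp only: second_quotient_le_iff[where q=q and x=x, OF \<mu>])
          moreover have "(t / s) *\<^sub>R s *\<^sub>R w' = t *\<^sub>R w'" "(t / s) * inner v (s *\<^sub>R w') = t * inner v w'"
            "1 / 2 * (t / s)\<^sup>2 * (s\<^sup>2 * \<beta>) = 1 / 2 * t\<^sup>2 * \<beta>"
            using \<open>s > 0\<close> by (simp_all add: power_divide)
          ultimately have "second_quotient q x v (t / s) (s *\<^sub>R w') \<le> ereal (s\<^sup>2 * \<beta>)"
            by (simp only: second_quotient_le_iff[where q=q and x=x, OF \<mu> t'(1)])
          then show False using b(2)[OF t'] w'(2) by (auto simp: epi_def)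
        qed
      qed
      with fr show False
        by (auto simp: frequently_def)
    qed
  qed
  then show ?thesis by (simp add: epi_second_subderiv)
qed

text \<open>Euler's identity for degree 2. Dilations move each epigraph point
  \<open>(y, \<beta>)\<close> along a curve inside the epigraph in both senses, so
  \<open>(y, 2 * \<beta>)\<close> and its negative are tangent and every regular normal is
  orthogonal to them; the orthogonality passes to limiting normals.\<close>

lemma subgradient_homogeneous:
  assumes hom: "\<And>w \<alpha> s. s > 0 \<Longrightarrow> (w, \<alpha>) \<in> epi \<phi> \<Longrightarrow> (s *\<^sub>R w, s\<^sup>2 * \<alpha>) \<in> epi \<phi>"
    and v: "v \<in> subdiff \<phi> w"
  shows "\<phi> w = ereal (inner v w / 2)"
proof -
  obtain \<mu> where \<mu>: "\<phi> w = ereal \<mu>" using v by (auto simp: subdiff_def)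
  obtain zs vs where zs: "\<And>k::nat. zs k \<in> epi \<phi>" "\<And>k. vs k \<in> regular_normal_cone (epi \<phi>) (zs k)"
    and lim: "zs \<longlonglongrightarrow> (w, \<mu>)" "vs \<longlonglongrightarrow> (v, -1)"
    using v \<mu> by (auto simp: subdiff_def limiting_normal_cone_def)
  have "inner (vs k) (fst (zs k), 2 * snd (zs k)) = 0" for k
  proof -
    obtain y \<beta> where y: "zs k = (y, \<beta>)" by (cases "zs k")
    have mem: "(y, \<beta>) + t *\<^sub>R (\<sigma> *\<^sub>R y, (2 * \<sigma> + t * \<sigma>\<^sup>2) * \<beta>) \<in> epi \<phi>" if "1 + t * \<sigma> > 0" for t \<sigma>
      using hom[OF that, of y \<beta>] zs(1)[of k]
      by (simp add: y algebra_simps power2_eq_square)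
    have tan: "(\<sigma> *\<^sub>R y, 2 * \<sigma> * \<beta>) \<in> tangent_cone (epi \<phi>) (y, \<beta>)" for \<sigma>
    proof (rule tangent_coneI)
      have "((\<lambda>t. (\<sigma> *\<^sub>R y, (2 * \<sigma> + t * \<sigma>\<^sup>2) * \<beta>)) \<longlongrightarrow> (\<sigma> *\<^sub>R y, (2 * \<sigma> + 0 * \<sigma>\<^sup>2) * \<beta>)) (at_right 0)"
        by (intro tendsto_intros)
      then show "((\<lambda>t. (\<sigma> *\<^sub>R y, (2 * \<sigma> + t * \<sigma>\<^sup>2) * \<beta>)) \<longlongrightarrow> (\<sigma> *\<^sub>R y, 2 * \<sigma> * \<beta>)) (at_right 0)"
        by simp
      have "((\<lambda>t. 1 + t * \<sigma>) \<longlongrightarrow> 1 + 0 * \<sigma>) (at_right 0)"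
        by (intro tendsto_intros)
      then have "\<forall>\<^sub>F t in at_right 0. 1 + t * \<sigma> > 0"
        by (intro order_tendstoD(1)) auto
      then show "\<forall>\<^sub>F t in at_right 0. (y, \<beta>) + t *\<^sub>R (\<sigma> *\<^sub>R y, (2 * \<sigma> + t * \<sigma>\<^sup>2) * \<beta>) \<in> epi \<phi>"
        by eventually_elim (use mem in blast)
    qed
    show ?thesis
      using polar_tangent_line[OF zs(2)[of k], of "(y, 2 * \<beta>)"] tan[of 1] tan[of "-1"]
      by (simp add: y)
  qed
  moreover have "(\<lambda>k. inner (vs k) (fst (zs k), 2 * snd (zs k))) \<longlonglongrightarrow>
      inner (v, -1) (fst (w, \<mu>), 2 * snd (w, \<mu>))"
    using lim by (intro tendsto_intros)
  ultimately have "inner (v, -1) (w, 2 * \<mu>) = 0"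
    by (simp add: LIMSEQ_const_iff)
  then show ?thesis using \<mu> by simp
qed

section \<open>Quadratic forms and subspaces of self-adjoint operators\<close>

text \<open>
  Firm nonexpansiveness together with self-adjointness is what characterizes the derivatives of
  proximal mappings below.
\<close>

definition firm_selfadjoint :: "('a::euclidean_space \<Rightarrow>\<^sub>L 'a) \<Rightarrow> bool" where
  "firm_selfadjoint A \<longleftrightarrow>
     (\<forall>h k. inner (A h) k = inner (A k) h) \<and> (\<forall>h. (norm (A h))\<^sup>2 \<le> inner (A h) h)"

definition qgraph :: "real \<Rightarrow> ('a::euclidean_space \<Rightarrow>\<^sub>L 'a) \<Rightarrow> ('a \<times> 'a) set" where
  "qgraph r A = range (\<lambda>h. (blinfun_apply A h, h - r *\<^sub>R A h))"

text \<open>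
  The Fenchel dual description of the form with value \<open>inner (A h) h - r * (norm (A h))\<^sup>2\<close> at \<open>A h\<close> and
  \<open>\<infinity>\<close> outside the range of \<open>A\<close>.
\<close>

definition qform :: "real \<Rightarrow> ('a::euclidean_space \<Rightarrow>\<^sub>L 'a) \<Rightarrow> 'a \<Rightarrow> ereal" where
  "qform r A w = (SUP h. ereal (2 * inner h w - inner (A h) h - r * (norm w)\<^sup>2))"

section \<open>The quadratic form of a self-adjoint operator\<close>

lemma firm_selfadjoint_norm_le:
  assumes "firm_selfadjoint A"
  shows "norm (blinfun_apply A h) \<le> norm h"
proof -
  have "(norm (A h))\<^sup>2 \<le> norm (A h) * norm h"
    using assms norm_cauchy_schwarz[of "A h" h] unfolding firm_selfadjoint_def by (meson order_trans)
  then show ?thesis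
    by (cases "norm (A h) = 0") (simp_all add: power2_eq_square)
qed

lemma epi_qform_iff:
  "(w, \<alpha>) \<in> epi (qform r A) \<longleftrightarrow> (\<forall>h. 2 * inner h w - inner (A h) h - r * (norm w)\<^sup>2 \<le> \<alpha>)"
  by (simp add: epi_def qform_def SUP_le_iff)

text \<open>The form is nonnegative at \<open>h - k\<close>; expand using symmetry. Consequently the
  supremum in \<open>qform\<close> at \<open>A h\<close> is attained at \<open>h\<close>.\<close>

lemma qform_apply_le:
  assumes "firm_selfadjoint A"
  shows "2 * inner k (A h) - inner (A k) k \<le> inner (A h) h"
proof -
  have "0 \<le> inner (A (h - k)) (h - k)"
    using assms unfolding firm_selfadjoint_def by (meson order_trans zero_le_power2)
  moreover have "inner (A h) k = inner (A k) h"
    using assms unfolding firm_selfadjoint_def by blast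
  ultimately show ?thesis
    by (simp add: blinfun.diff_right inner_diff inner_commute)
qed

text \<open>The part \<open>n\<close> of \<open>w\<close> orthogonal to the range lies in the kernel
  by symmetry. Along multiples of \<open>n\<close> the quadratic term vanishes while the linear one
  is unbounded, unless \<open>n = 0\<close>. Hence \<open>qform\<close> is infinite off the
  range.\<close>

lemma selfadjoint_in_rangeI:
  assumes "firm_selfadjoint A" and bd: "\<And>h. 2 * inner h w - inner (A h) h \<le> \<beta>"
  shows "w \<in> range (blinfun_apply A)"
proof -
  have sub: "subspace (range (blinfun_apply A))"
    using linear_subspace_image[OF bounded_linear.linear[OF blinfun.bounded_linear_right] subspace_UNIV] by simp
  obtain y n where y: "y \<in> range (blinfun_apply A)" and n: "\<And>u. u \<in> range (blinfun_apply A) \<Longrightarrow> orthogonal n u"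
    and w: "w = y + n"
    using orthogonal_subspace_decomp_exists[of "range (blinfun_apply A)" w]
    by (metis span_eq_iff sub)
  have "inner (A n) k = 0" for k
    using n[of "A k"] assms(1) unfolding firm_selfadjoint_def orthogonal_def by (metis inner_commute rangeI)
  then have An: "A n = 0" by (metis inner_eq_zero_iff)
  have ny: "inner n y = 0" using n[OF y] by (simp add: orthogonal_def)
  have *: "2 * s * (norm n)\<^sup>2 \<le> \<beta>" for s
    using bd[of "s *\<^sub>R n"] by (simp add: w blinfun.scaleR_right An inner_add ny power2_norm_eq_inner)
  have "n = 0"
  proof (rule ccontr)
    assume "n \<noteq> 0"
    then show False using *[of "(\<bar>\<beta>\<bar> + 1) / (norm n)\<^sup>2"] by simp
  qed
  then show ?thesis using y w by simp
qed

lemma epi_qform: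
  assumes "firm_selfadjoint A"
  shows "epi (qform r A) =
    {(blinfun_apply A h, \<alpha>) | h \<alpha>. inner (A h) h - r * (norm (A h))\<^sup>2 \<le> \<alpha>}"
proof (intro set_eqI iffI)
  fix z assume "z \<in> epi (qform r A)"
  then obtain w \<alpha> where z: "z = (w, \<alpha>)" and bd: "\<And>h. 2 * inner h w - inner (A h) h - r * (norm w)\<^sup>2 \<le> \<alpha>"
    by (cases z) (auto simp: epi_qform_iff)
  have "2 * inner h w - inner (A h) h \<le> \<alpha> + r * (norm w)\<^sup>2" for h
    using bd[of h] by simp
  then obtain h where h: "w = A h"
    using selfadjoint_in_rangeI[OF assms] by blast
  have "inner (A h) h - r * (norm (A h))\<^sup>2 \<le> \<alpha>"
    using bd[of h] by (simp add: h inner_commute)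
  then show "z \<in> {(blinfun_apply A h, \<alpha>) | h \<alpha>. inner (A h) h - r * (norm (A h))\<^sup>2 \<le> \<alpha>}"
    using z h by blast
next
  fix z assume "z \<in> {(blinfun_apply A h, \<alpha>) | h \<alpha>. inner (A h) h - r * (norm (A h))\<^sup>2 \<le> \<alpha>}"
  then obtain h \<alpha> where z: "z = (A h, \<alpha>)" "inner (A h) h - r * (norm (A h))\<^sup>2 \<le> \<alpha>" by blast
  show "z \<in> epi (qform r A)"
    unfolding z(1) epi_qform_iff using qform_apply_le[OF assms] z(2) by (smt (verit))
qed

lemma qform_apply:
  assumes "firm_selfadjoint A"
  shows "qform r A (A h) = ereal (inner (A h) h - r * (norm (A h))\<^sup>2)"
proof (rule antisym)
  show "qform r A (A h) \<le> ereal (inner (A h) h - r * (norm (A h))\<^sup>2)"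
    using epi_qform[OF assms, of r] unfolding epi_iff[symmetric] by blast
  show "ereal (inner (A h) h - r * (norm (A h))\<^sup>2) \<le> qform r A (A h)"
    unfolding qform_def by (rule SUP_upper2[of h]) (auto simp: inner_commute)
qed

lemma epi_scaled:
  assumes "c > 0"
  shows "(w, \<alpha>) \<in> epi (\<lambda>w. ereal c * \<phi> w) \<longleftrightarrow> (w, \<alpha> / c) \<in> epi \<phi>"
proof (cases "\<phi> w")
  case (real \<beta>)
  then show ?thesis using assms by (simp add: epi_def field_simps)
qed (use assms in \<open>auto simp: epi_def\<close>)

text \<open>Each \<open>h\<close> supplies a global quadratic minorant touching the form at
  \<open>A h\<close>, which gives one inclusion. For the other, regular normals satisfy a linear
  equation involving the base point; it survives limits, and with last component \<open>-1\<close>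
  it can be solved for \<open>h\<close>. The factor \<open>c\<close> covers the form itself and its
  half.\<close>

lemma gph_subdiff_qform:
  fixes A :: "'a::euclidean_space \<Rightarrow>\<^sub>L 'a"
  assumes A: "firm_selfadjoint A" and c: "c > 0"
  shows "gph (subdiff (\<lambda>w. ereal c * qform r A w)) = range (\<lambda>h. (blinfun_apply A h, (2 * c) *\<^sub>R (h - r *\<^sub>R A h)))"
    (is "gph (subdiff ?\<phi>) = ?R")
proof (intro set_eqI iffI)
  fix z assume "z \<in> ?R"
  then obtain h where z: "z = (A h, (2 * c) *\<^sub>R (h - r *\<^sub>R A h))" by blast
  let ?v = "(2 * c) *\<^sub>R (h - r *\<^sub>R A h)"
  have "?v \<in> subdiff ?\<phi> (A h)"
  proof (rule proximal_subgradient[where U = UNIV and c = "c * r"])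
    show "\<bar>?\<phi> (A h)\<bar> \<noteq> \<infinity>" by (simp add: qform_apply[OF A])
    fix y
    have "ereal (2 * inner h y - inner (A h) h - r * (norm y)\<^sup>2) \<le> qform r A y"
      unfolding qform_def by (rule SUP_upper) simp
    then have "ereal c * ereal (2 * inner h y - inner (A h) h - r * (norm y)\<^sup>2) \<le> ?\<phi> y"
      using c by (intro ereal_mult_left_mono) auto
    moreover have "?\<phi> (A h) + ereal (inner ?v (y - A h) - c * r * (norm (y - A h))\<^sup>2)
        = ereal c * ereal (2 * inner h y - inner (A h) h - r * (norm y)\<^sup>2)"
      by (simp add: qform_apply[OF A] power2_norm_eq_inner inner_diff inner_commute algebra_simps)
    ultimately show "?\<phi> (A h) + ereal (inner ?v (y - A h) - c * r * (norm (y - A h))\<^sup>2) \<le> ?\<phi> y"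
      by simp
  qed auto
  then show "z \<in> gph (subdiff ?\<phi>)" by (simp add: z gph_def)
next
  fix z assume "z \<in> gph (subdiff ?\<phi>)"
  then obtain w v where z: "z = (w, v)" and v: "v \<in> subdiff ?\<phi> w" by (auto simp: gph_def)
  obtain \<mu> zs vs where zs: "\<And>k::nat. zs k \<in> epi ?\<phi>" "\<And>k. vs k \<in> regular_normal_cone (epi ?\<phi>) (zs k)"
    and lim: "zs \<longlonglongrightarrow> (w, \<mu>)" "vs \<longlonglongrightarrow> (v, -1)"
    using v by (auto simp: subdiff_def limiting_normal_cone_def)
  have "A (fst (vs k)) + (2 * c * snd (vs k)) *\<^sub>R (fst (zs k) - r *\<^sub>R A (fst (zs k))) = 0" for k
  proof -
    obtain h \<alpha> where y: "zs k = (A h, \<alpha>)" and le: "inner (A h) h - r * (norm (A h))\<^sup>2 \<le> \<alpha> / c"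
      using zs(1)[of k] epi_scaled[OF c, of "fst (zs k)" "snd (zs k)" "qform r A"] epi_qform[OF A, of r]
      by (cases "zs k") auto
    obtain u \<beta> where u: "vs k = (u, \<beta>)" by (cases "vs k")
    let ?b = "\<lambda>l. 2 * inner (A l) (h - r *\<^sub>R A h)"
    let ?g = "\<lambda>l. inner (A l) (l - r *\<^sub>R A l)"
    have sym: "inner (A a) b = inner (A b) a" for a b
      using A unfolding firm_selfadjoint_def by blast
    \<comment> \<open>Moving the parameter from \<open>h\<close> to \<open>h + t *\<^sub>R l\<close>
      and lifting by the change of the form stays in the epigraph, also when \<open>\<alpha>\<close>
      lies strictly above the graph. As \<open>- l\<close> is allowed too, the tangents come in
      opposite pairs.\<close>
    have mem: "(A h, \<alpha>) + t *\<^sub>R (A l, c * ?b l + t * (c * ?g l)) \<in> epi ?\<phi>" for t l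
    proof -
      have "inner (A (h + t *\<^sub>R l)) (h + t *\<^sub>R l) - r * (norm (A (h + t *\<^sub>R l)))\<^sup>2 =
          inner (A h) h - r * (norm (A h))\<^sup>2 + t * (?b l + t * ?g l)"
        using sym[of l h]
        by (simp add: power2_norm_eq_inner blinfun.add_right blinfun.scaleR_right inner_diff inner_add
            inner_commute algebra_simps)
      also have "\<dots> \<le> (\<alpha> + t * (c * ?b l + t * (c * ?g l))) / c"
        using le c by (simp add: field_simps)
      finally have "(A (h + t *\<^sub>R l), (\<alpha> + t * (c * ?b l + t * (c * ?g l))) / c) \<in> epi (qform r A)"
        unfolding epi_qform[OF A] by blast
      then show ?thesis
        by (simp add: epi_scaled[OF c] blinfun.add_right blinfun.scaleR_right)
    qed
    have tan: "(A l, c * ?b l) \<in> tangent_cone (epi ?\<phi>) (A h, \<alpha>)" for l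
    proof (rule tangent_coneI)
      have "((\<lambda>t. (A l, c * ?b l + t * (c * ?g l))) \<longlongrightarrow> (A l, c * ?b l + 0 * (c * ?g l))) (at_right 0)"
        by (intro tendsto_intros)
      then show "((\<lambda>t. (A l, c * ?b l + t * (c * ?g l))) \<longlongrightarrow> (A l, c * ?b l)) (at_right 0)" by simp
    qed (use mem in auto)
    have "inner (A u + (2 * c * \<beta>) *\<^sub>R (A h - r *\<^sub>R A (A h))) l = 0" for l
    proof -
      have "- (A l, c * ?b l) \<in> tangent_cone (epi ?\<phi>) (A h, \<alpha>)"
        using tan[of "- l"] by (simp add: blinfun.minus_right)
      from polar_tangent_line[OF zs(2)[of k, unfolded y] tan this]
      have "inner u (A l) + \<beta> * (c * ?b l) = 0" by (simp add: u)
      then show ?thesis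
        using sym[of u l] sym[of h l] sym[of "A h" l]
        by (simp add: inner_add inner_diff inner_commute algebra_simps)
    qed
    then have "A u + (2 * c * \<beta>) *\<^sub>R (A h - r *\<^sub>R A (A h)) = 0"
      by (metis inner_eq_zero_iff)
    then show ?thesis by (simp add: y u)
  qed
  moreover have "(\<lambda>k. A (fst (vs k)) + (2 * c * snd (vs k)) *\<^sub>R (fst (zs k) - r *\<^sub>R A (fst (zs k))))
      \<longlonglongrightarrow> A (fst (v, -1::real)) + (2 * c * snd (v, -1::real)) *\<^sub>R (fst (w, \<mu>) - r *\<^sub>R A (fst (w, \<mu>)))"
    using lim by (intro tendsto_intros)
  ultimately have eq: "A v - (2 * c) *\<^sub>R (w - r *\<^sub>R A w) = 0"
    by (simp add: LIMSEQ_const_iff)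
  \<comment> \<open>The parameter is forced: \<open>2 * c\<close> times \<open>h - r w\<close> must
    be \<open>v\<close>, so \<open>h\<close> is \<open>v / (2 * c) + r w\<close>. The normal
    equation then says \<open>A ?h = w\<close>.\<close>
  let ?h = "(1 / (2 * c)) *\<^sub>R v + r *\<^sub>R w"
  have "(2 * c) *\<^sub>R A ?h = A v + (2 * c) *\<^sub>R r *\<^sub>R A w"
    using c by (simp add: blinfun.add_right blinfun.scaleR_right scaleR_add_right)
  also have "\<dots> = (2 * c) *\<^sub>R w"
    using eq by (simp add: algebra_simps)
  finally have "A ?h = w" using c by simp
  moreover have "(2 * c) *\<^sub>R (?h - r *\<^sub>R A ?h) = v"
    using c by (simp add: \<open>A ?h = w\<close>)
  ultimately show "z \<in> ?R" unfolding z by (intro image_eqI[where x = ?h]) (simp_all only: UNIV_I)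
qed

lemma linear_qgraph_param: "linear (\<lambda>h. (blinfun_apply A h, h - r *\<^sub>R A h))"
  by (rule linearI) (simp_all add: blinfun.add_right blinfun.scaleR_right algebra_simps)

lemma gph_half_qform:
  assumes "firm_selfadjoint A"
  shows "gph (subdiff (\<lambda>w. ereal (1 / 2) * qform r A w)) = qgraph r A"
  using gph_subdiff_qform[OF assms, of "1/2" r] by (simp add: qgraph_def)

lemma generalized_quadratic_form_qform:
  assumes "firm_selfadjoint A"
  shows "generalized_quadratic_form (qform r A)"
proof -
  have "linear (\<lambda>h. (blinfun_apply A h, 2 *\<^sub>R (h - r *\<^sub>R A h)))"
    by (rule linearI) (simp_all add: blinfun.add_right blinfun.scaleR_right algebra_simps)
  then have "subspace (gph (subdiff (qform r A)))"
    using gph_subdiff_qform[OF assms zero_less_one, of r] linear_subspace_image[OF _ subspace_UNIV]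
    by simp
  then show ?thesis
    using qform_apply[OF assms, of r 0] by (simp add: generalized_quadratic_form_def zero_ereal_def)
qed

section \<open>Operator graphs as subspaces\<close>

lemma subspace_qgraph: "subspace (qgraph r A)"
  unfolding qgraph_def using linear_subspace_image[OF linear_qgraph_param subspace_UNIV] .

lemma qgraph_in_Zspaces: "qgraph r A \<in> Zspaces"
proof -
  have "inj (\<lambda>h. (blinfun_apply A h, h - r *\<^sub>R A h))"
    by (rule injI) auto
  then have "dim (qgraph r A) = dim (UNIV :: 'a set)"
    unfolding qgraph_def by (intro dim_image_eq linear_qgraph_param) auto
  then show ?thesis by (simp add: Zspaces_def subspace_qgraph)
qed

text \<open>Symmetry of \<open>A\<close> turns orthogonality to all graph points into the single
  equation \<open>A u + v - r A v = 0\<close>, whose solutions are parametrized by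
  \<open>h = u - r v\<close>.\<close>

lemma adjoint_qgraph:
  assumes "firm_selfadjoint A"
  shows "adjoint_subspace (qgraph r A) = qgraph r A"
proof -
  have sym: "inner (A a) b = inner (A b) a" for a b
    using assms unfolding firm_selfadjoint_def by blast
  have perp: "(u, v) \<in> orthogonal_comp (qgraph r A) \<longleftrightarrow> A u + v - r *\<^sub>R A v = 0" for u v
  proof -
    have "inner (A h, h - r *\<^sub>R A h) (u, v) = inner (A u + v - r *\<^sub>R A v) h" for h
      using sym[of h u] sym[of h v] by (simp add: inner_diff inner_add inner_commute)
    then have "(u, v) \<in> orthogonal_comp (qgraph r A) \<longleftrightarrow> (\<forall>h. inner (A u + v - r *\<^sub>R A v) h = 0)"
      by (auto simp: orthogonal_comp_def qgraph_def orthogonal_def)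
    then show ?thesis by (metis inner_eq_zero_iff inner_zero_left)
  qed
  have "A u + v - r *\<^sub>R A v = 0 \<longleftrightarrow> (\<exists>h. - v = A h \<and> u = h - r *\<^sub>R A h)" for u v
  proof
    assume eq: "A u + v - r *\<^sub>R A v = 0"
    have "A (u - r *\<^sub>R v) = - v"
      using eq by (simp add: blinfun.diff_right blinfun.scaleR_right algebra_simps)
    then show "\<exists>h. - v = A h \<and> u = h - r *\<^sub>R A h"
      by (intro exI[of _ "u - r *\<^sub>R v"]) simp
  next
    assume "\<exists>h. - v = A h \<and> u = h - r *\<^sub>R A h"
    then obtain h where h: "v = - A h" "u = h - r *\<^sub>R A h" by (metis minus_minus)
    show "A u + v - r *\<^sub>R A v = 0"
      by (simp add: h blinfun.diff_right blinfun.scaleR_right blinfun.minus_right)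
  qed
  then have "adjoint_subspace (qgraph r A) = {(- v, u) | u v. \<exists>h. - v = A h \<and> u = h - r *\<^sub>R A h}"
    unfolding adjoint_subspace_def perp by simp
  also have "\<dots> = qgraph r A"
  proof (intro set_eqI iffI)
    fix z assume "z \<in> qgraph r A"
    then obtain h where "z = (A h, h - r *\<^sub>R A h)" by (auto simp: qgraph_def)
    then have "z = (- (- A h), h - r *\<^sub>R A h) \<and> (\<exists>k. - (- A h) = A k \<and> h - r *\<^sub>R A h = k - r *\<^sub>R A k)"
      by auto
    then show "z \<in> {(- v, u) | u v. \<exists>h. - v = A h \<and> u = h - r *\<^sub>R A h}" by blast
  qed (auto simp: qgraph_def)
  finally show ?thesis .
qed

text \<open>Used both for \<open>t\<close> tending to 0 and for sequences of operators. The bounds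
  in \<open>lower\<close> are Fenchel inequalities for fixed \<open>h\<close>; in the limit they put
  every outer limit point above the supremum defining \<open>qform\<close>. \<open>recovery\<close>
  reaches the graph, and vertical shifts reach the rest of the epigraph. Bounds on bounded sets of
  \<open>w\<close> suffice because outer limits are local.\<close>

lemma epi_converges_qformI:
  fixes A :: "'a::euclidean_space \<Rightarrow>\<^sub>L 'a"
  assumes A: "firm_selfadjoint A" and "F \<noteq> bot"
    and c: "\<And>h. ((\<lambda>i. c i h) \<longlongrightarrow> inner (A h) h) F"
    and lower: "\<And>h R. \<forall>\<^sub>F i in F. \<forall>w \<alpha>. norm w < R \<longrightarrow> f i w \<le> ereal \<alpha> \<longrightarrow>
        2 * inner h w - c i h - r * (norm w)\<^sup>2 \<le> \<alpha>"
    and recovery: "\<And>h. \<exists>y. (y \<longlongrightarrow> (A h, inner (A h) h - r * (norm (A h))\<^sup>2)) F \<and> (\<forall>\<^sub>F i in F. y i \<in> epi (f i))"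
  shows "epi_converges f (qform r A) F"
proof -
  let ?C = "\<lambda>i. epi (f i)"
  have "outer_limit ?C F \<subseteq> epi (qform r A)"
  proof
    fix z assume z: "z \<in> outer_limit ?C F"
    obtain w \<alpha> where zw: "z = (w, \<alpha>)" by (cases z)
    have "2 * inner h w - inner (A h) h - r * (norm w)\<^sup>2 \<le> \<alpha>" for h
    proof (rule ccontr)
      assume neg: "\<not> ?thesis"
      define e where "e = (2 * inner h w - inner (A h) h - r * (norm w)\<^sup>2 - \<alpha>) / 2"
      have "e > 0" using neg by (simp add: e_def)
      let ?U = "{y. norm (fst y) < norm w + 1} \<inter>
          {y. inner (A h) h + e < 2 * inner h (fst y) - r * (norm (fst y))\<^sup>2 - snd y}"
      have "open ?U"
        by (intro open_Int open_Collect_less continuous_intros)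
      moreover have "(w, \<alpha>) \<in> ?U" using \<open>e > 0\<close> by (simp add: e_def field_simps)
      ultimately have fr: "\<exists>\<^sub>F i in F. ?C i \<inter> ?U \<noteq> {}"
        using z unfolding zw outer_limit_def by blast
      have "\<forall>\<^sub>F i in F. c i h < inner (A h) h + e"
        using c \<open>e > 0\<close> by (intro order_tendstoD(2)) auto
      with lower[of "norm w + 1" h] have "\<forall>\<^sub>F i in F. ?C i \<inter> ?U = {}"
        by eventually_elim (fastforce simp: epi_def)
      with fr show False by (simp add: frequently_def)
    qed
    then show "z \<in> epi (qform r A)" by (simp add: zw epi_qform_iff)
  qed
  moreover have "epi (qform r A) \<subseteq> inner_limit ?C F"
  proof
    fix z assume "z \<in> epi (qform r A)"
    then obtain h \<alpha> where z: "z = (A h, \<alpha>)" and le: "inner (A h) h - r * (norm (A h))\<^sup>2 \<le> \<alpha>"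
      unfolding epi_qform[OF A] by blast
    define b where "b = \<alpha> - (inner (A h) h - r * (norm (A h))\<^sup>2)"
    obtain y where y: "(y \<longlongrightarrow> (A h, inner (A h) h - r * (norm (A h))\<^sup>2)) F" "\<forall>\<^sub>F i in F. y i \<in> ?C i"
      using recovery by blast
    have "((\<lambda>i. y i + (0, b)) \<longlongrightarrow> (A h, inner (A h) h - r * (norm (A h))\<^sup>2) + (0, b)) F"
      using y by (intro tendsto_intros)
    then have lim: "((\<lambda>i. y i + (0, b)) \<longlongrightarrow> z) F" by (simp add: z b_def)
    have mem: "\<forall>\<^sub>F i in F. y i + (0, b) \<in> ?C i"
      using y(2)
    proof eventually_elim
      case (elim i)
      have "b \<ge> 0" using le by (simp add: b_def)
      then have "ereal (snd (y i)) \<le> ereal (snd (y i) + b)" by simp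
      then show ?case
        using elim by (cases "y i") (auto simp: epi_def intro: order_trans)
    qed
    show "z \<in> inner_limit ?C F"
      unfolding inner_limit_def
    proof (intro CollectI allI impI)
      fix U assume "open U \<and> z \<in> U"
      then have "\<forall>\<^sub>F i in F. y i + (0, b) \<in> U" using lim topological_tendstoD by blast
      with mem show "\<forall>\<^sub>F i in F. ?C i \<inter> U \<noteq> {}" by eventually_elim auto
    qed
  qed
  moreover have "inner_limit ?C F \<subseteq> outer_limit ?C F"
    using eventually_frequently[OF \<open>F \<noteq> bot\<close>] unfolding inner_limit_def outer_limit_def by blast
  ultimately show ?thesis unfolding epi_converges_def by blast
qed

lemma qform_epi_converges:
  assumes A: "firm_selfadjoint A" "\<And>k. firm_selfadjoint (B k)" and lim: "B \<longlonglongrightarrow> A"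
  shows "epi_converges (\<lambda>k. qform r (B k)) (qform r A) sequentially"
proof (rule epi_converges_qformI[OF A(1) sequentially_bot, where c = "\<lambda>k h. inner (B k h) h"])
  show "(\<lambda>k. inner (B k h) h) \<longlonglongrightarrow> inner (A h) h" for h
    using lim by (intro tendsto_intros)
  show "\<forall>\<^sub>F k in sequentially. \<forall>w \<alpha>. norm w < R \<longrightarrow> qform r (B k) w \<le> ereal \<alpha> \<longrightarrow>
        2 * inner h w - inner (B k h) h - r * (norm w)\<^sup>2 \<le> \<alpha>" for h R
    by (intro always_eventually) (auto simp: epi_qform_iff simp flip: epi_iff)
  show "\<exists>y. y \<longlonglongrightarrow> (A h, inner (A h) h - r * (norm (A h))\<^sup>2) \<and>
      (\<forall>\<^sub>F k in sequentially. y k \<in> epi (qform r (B k)))" for h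
  proof (intro exI[of _ "\<lambda>k. (B k h, inner (B k h) h - r * (norm (B k h))\<^sup>2)"] conjI)
    show "(\<lambda>k. (B k h, inner (B k h) h - r * (norm (B k h))\<^sup>2)) \<longlonglongrightarrow> (A h, inner (A h) h - r * (norm (A h))\<^sup>2)"
      using lim by (intro tendsto_intros)
  qed (simp add: epi_def qform_apply[OF A(2)])
qed

text \<open>Firm nonexpansiveness bounds the norms by 1, the operators form a finite-dimensional
  space, and both defining conditions are closed.\<close>

lemma compact_firm_selfadjoint:
  fixes B :: "nat \<Rightarrow> ('a::euclidean_space \<Rightarrow>\<^sub>L 'a)"
  assumes B: "\<And>k. firm_selfadjoint (B k)"
  obtains A s where "strict_mono s" "(\<lambda>k. B (s k)) \<longlonglongrightarrow> A" "firm_selfadjoint A"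
proof -
  have "norm (B k) \<le> 1" for k
    by (rule norm_blinfun_bound) (use firm_selfadjoint_norm_le[OF B] in auto)
  then have "bounded (range B)"
    by (auto simp: bounded_iff)
  then obtain A s where s: "strict_mono s" "(B \<circ> s) \<longlonglongrightarrow> A"
    using bounded_imp_convergent_subsequence by blast
  then have lim: "(\<lambda>k. B (s k)) \<longlonglongrightarrow> A" by (simp add: o_def)
  have "inner (A h) k = inner (A k) h" for h k
  proof -
    have "(\<lambda>n. inner (B (s n) h) k) \<longlonglongrightarrow> inner (A h) k" for h k
      using lim by (intro tendsto_intros)
    from this[of h k] this[of k h] have "(\<lambda>n. inner (B (s n) h) k) \<longlonglongrightarrow> inner (A h) k"
        "(\<lambda>n. inner (B (s n) k) h) \<longlonglongrightarrow> inner (A k) h" .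
    moreover have "(\<lambda>n. inner (B (s n) h) k) = (\<lambda>n. inner (B (s n) k) h)"
      using B by (auto simp: firm_selfadjoint_def)
    ultimately show ?thesis using LIMSEQ_unique by metis
  qed
  moreover have "(norm (A h))\<^sup>2 \<le> inner (A h) h" for h
  proof (rule tendsto_le[OF sequentially_bot])
    show "(\<lambda>n. inner (B (s n) h) h) \<longlonglongrightarrow> inner (A h) h" "(\<lambda>n. (norm (B (s n) h))\<^sup>2) \<longlonglongrightarrow> (norm (A h))\<^sup>2"
      using lim by (auto intro!: tendsto_intros)
    show "\<forall>\<^sub>F n in sequentially. (norm (B (s n) h))\<^sup>2 \<le> inner (B (s n) h) h"
      using B by (auto simp: firm_selfadjoint_def)
  qed
  ultimately show thesis using that s(1) lim by (auto simp: firm_selfadjoint_def)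
qed

section \<open>Orthogonal projections and the metric on subspaces\<close>

lemma orth_proj:
  assumes "subspace L"
  shows orth_proj_mem: "orth_proj L z \<in> L"
    and orth_proj_perp: "z - orth_proj L z \<in> orthogonal_comp L"
    and orth_proj_eqI: "p \<in> L \<Longrightarrow> z - p \<in> orthogonal_comp L \<Longrightarrow> orth_proj L z = p"
proof -
  have uniq: "p = p'" if "p \<in> L" "z - p \<in> orthogonal_comp L" "p' \<in> L" "z - p' \<in> orthogonal_comp L" for p p'
  proof -
    have "p - p' \<in> L" using that assms by (simp add: subspace_diff)
    then have "inner (z - p) (p - p') = 0" "inner (z - p') (p - p') = 0"
      using that by (auto simp: orthogonal_comp_def orthogonal_def inner_commute)
    then have "inner (p - p') (p - p') = 0" by (simp add: inner_diff)
    then show ?thesis by simp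
  qed
  obtain y n where "y \<in> L" "\<And>u. u \<in> L \<Longrightarrow> orthogonal n u" "z = y + n"
    using orthogonal_subspace_decomp_exists[of L z] assms by (metis span_eq_iff)
  then have ex: "y \<in> L" "z - y \<in> orthogonal_comp L"
    by (auto simp: orthogonal_comp_def orthogonal_commute)
  have "orth_proj L z = y"
    unfolding orth_proj_def using ex uniq by (intro the_equality) auto
  then show "orth_proj L z \<in> L" "z - orth_proj L z \<in> orthogonal_comp L" using ex by auto
  show "orth_proj L z = p" if "p \<in> L" "z - p \<in> orthogonal_comp L"
    unfolding orth_proj_def using that uniq by (intro the_equality) auto
qed

lemma linear_orth_proj:
  assumes "subspace L"
  shows "linear (orth_proj L)"
proof (rule linearI)
  note comp = subspace_orthogonal_comp[of L]
  show "orth_proj L (a + b) = orth_proj L a + orth_proj L b" for a b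
  proof (rule orth_proj_eqI[OF assms])
    have "(a - orth_proj L a) + (b - orth_proj L b) \<in> orthogonal_comp L"
      using orth_proj_perp[OF assms] subspace_add[OF comp] by blast
    then show "a + b - (orth_proj L a + orth_proj L b) \<in> orthogonal_comp L"
      by (simp add: algebra_simps)
  qed (use assms orth_proj_mem subspace_add in blast)
  show "orth_proj L (c *\<^sub>R a) = c *\<^sub>R orth_proj L a" for c a
  proof (rule orth_proj_eqI[OF assms])
    have "c *\<^sub>R (a - orth_proj L a) \<in> orthogonal_comp L"
      using orth_proj_perp[OF assms] subspace_scale[OF comp] by blast
    then show "c *\<^sub>R a - c *\<^sub>R orth_proj L a \<in> orthogonal_comp L"
      by (simp add: algebra_simps)
  qed (use assms orth_proj_mem subspace_scale in blast)
qed

lemma bounded_linear_orth_proj_diff: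
  "subspace L \<Longrightarrow> subspace M \<Longrightarrow> bounded_linear (\<lambda>z. orth_proj L z - orth_proj M z)"
  using linear_orth_proj by (intro bounded_linear_sub) (simp_all add: linear_conv_bounded_linear)

lemma dist_Z_triangle:
  assumes "subspace L" "subspace M" "subspace N"
  shows "dist_Z L N \<le> dist_Z L M + dist_Z M N"
  using onorm_triangle[OF bounded_linear_orth_proj_diff[OF assms(1,2)] bounded_linear_orth_proj_diff[OF assms(2,3)]]
  unfolding dist_Z_def by simp

lemma dist_Z_commute: "dist_Z L M = dist_Z M L"
  using onorm_neg[of "\<lambda>z. orth_proj L z - orth_proj M z"]
  unfolding dist_Z_def by simp

lemma dist_Z_nonneg: "subspace L \<Longrightarrow> subspace M \<Longrightarrow> 0 \<le> dist_Z L M"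
  unfolding dist_Z_def by (intro onorm_pos_le bounded_linear_orth_proj_diff)

lemma dist_Z_eq_0D:
  assumes "subspace L" "subspace M" "dist_Z L M = 0"
  shows "L = M"
proof -
  have eq: "orth_proj L z = orth_proj M z" for z
    using assms(3) onorm_eq_0[OF bounded_linear_orth_proj_diff[OF assms(1,2)]]
    unfolding dist_Z_def by (metis eq_iff_diff_eq_0)
  have id: "orth_proj K z = z" if "subspace K" "z \<in> K" for K :: "('a \<times> 'a) set" and z
    by (rule orth_proj_eqI[OF that]) (use subspace_orthogonal_comp subspace_0 in auto)
  show ?thesis
    using eq id orth_proj_mem assms by (metis subset_antisym subsetI)
qed

lemma dist_Z_limit_unique:
  assumes sub: "subspace L" "subspace M" "\<And>k. subspace (N k)"
    and lim: "(\<lambda>k. dist_Z L (N k)) \<longlonglongrightarrow> 0" "(\<lambda>k. dist_Z M (N k)) \<longlonglongrightarrow> 0"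
  shows "L = M"
proof (rule dist_Z_eq_0D[OF sub(1,2)], rule antisym)
  have "(\<lambda>k. dist_Z L (N k) + dist_Z M (N k)) \<longlonglongrightarrow> 0 + 0"
    using lim by (rule tendsto_add)
  moreover have "dist_Z L M \<le> dist_Z L (N k) + dist_Z M (N k)" for k
    using dist_Z_triangle[OF sub(1) sub(3) sub(2), of k] dist_Z_commute[of M "N k"] by simp
  ultimately show "dist_Z L M \<le> 0"
    by (intro tendsto_lowerbound[of _ _ sequentially]) auto
qed (use dist_Z_nonneg sub in blast)

lemma orth_proj_norm_le:
  assumes "subspace L"
  shows "norm (orth_proj L z) \<le> norm z" "norm (z - orth_proj L z) \<le> norm z"
proof -
  let ?p = "orth_proj L z"
  have "inner ?p (z - ?p) = 0"
    using orth_proj_perp[OF assms, of z] orth_proj_mem[OF assms, of z]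
    by (auto simp: orthogonal_comp_def orthogonal_def)
  then have "(norm ?p)\<^sup>2 + (norm (z - ?p))\<^sup>2 = (norm z)\<^sup>2"
    by (simp add: power2_norm_eq_inner inner_diff inner_commute)
  then have "(norm ?p)\<^sup>2 \<le> (norm z)\<^sup>2" "(norm (z - ?p))\<^sup>2 \<le> (norm z)\<^sup>2"
    by (smt (verit) zero_le_power2)+
  then show "norm ?p \<le> norm z" "norm (z - ?p) \<le> norm z"
    by (simp_all add: power2_le_iff_abs_le)
qed

text \<open>The residual \<open>z - ?p B\<close> is orthogonal to the graph of \<open>B\<close>, so
  in its product with the projection \<open>?p A = ?g A h\<close> the latter may be replaced by
  \<open>?g A h - ?g B h\<close>, which is small with \<open>A - B\<close>; likewise with the roles
  exchanged. This controls the square of the distance between the projections, hence the square root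
  in the bound.\<close>

lemma dist_Z_qgraph_le:
  fixes A B :: "'a::euclidean_space \<Rightarrow>\<^sub>L 'a"
  shows "dist_Z (qgraph r A) (qgraph r B) \<le> sqrt (2 * (1 + \<bar>r\<bar>)\<^sup>2 * norm (A - B))"
  unfolding dist_Z_def
proof (rule onorm_bound)
  fix z :: "'a \<times> 'a"
  let ?g = "\<lambda>C h. (blinfun_apply C h, h - r *\<^sub>R C h)"
  let ?p = "\<lambda>C. orth_proj (qgraph r C) z"
  have gdiff: "norm (?g A h - ?g B h) \<le> (1 + \<bar>r\<bar>) * norm (A - B) * norm h" for h
  proof -
    have "?g A h - ?g B h = ((A - B) h, - r *\<^sub>R (A - B) h)"
      by (simp add: blinfun.diff_left algebra_simps)
    then have "norm (?g A h - ?g B h) \<le> norm ((A - B) h) + norm (- r *\<^sub>R (A - B) h)"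
      using norm_Pair_le by metis
    also have "\<dots> = (1 + \<bar>r\<bar>) * norm ((A - B) h)" by (simp add: algebra_simps)
    also have "\<dots> \<le> (1 + \<bar>r\<bar>) * (norm (A - B) * norm h)"
      by (intro mult_left_mono norm_blinfun) auto
    finally show ?thesis by simp
  qed
  have ex: "\<exists>h. ?p C = ?g C h \<and> norm h \<le> (1 + \<bar>r\<bar>) * norm z" for C :: "'a \<Rightarrow>\<^sub>L 'a"
  proof -
    obtain h where h: "?p C = ?g C h"
      using orth_proj_mem[OF subspace_qgraph[of r C], of z] unfolding qgraph_def by blast
    then have "h = r *\<^sub>R fst (?p C) + snd (?p C)" by simp
    then have "norm h \<le> \<bar>r\<bar> * norm (fst (?p C)) + norm (snd (?p C))"
      by (metis norm_scaleR norm_triangle_ineq)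
    also have "\<dots> \<le> \<bar>r\<bar> * norm (?p C) + norm (?p C)"
      by (metis abs_ge_zero add_mono mult_left_mono norm_fst_le norm_snd_le prod.collapse)
    also have "\<dots> = (1 + \<bar>r\<bar>) * norm (?p C)" by (simp add: algebra_simps)
    also have "\<dots> \<le> (1 + \<bar>r\<bar>) * norm z"
      by (intro mult_left_mono orth_proj_norm_le subspace_qgraph) auto
    finally show ?thesis using h by blast
  qed
  obtain h where h: "?p A = ?g A h" "norm h \<le> (1 + \<bar>r\<bar>) * norm z" using ex by blast
  obtain k where k: "?p B = ?g B k" "norm k \<le> (1 + \<bar>r\<bar>) * norm z" using ex by blast
  have perp: "inner (z - ?p C) (?g C l) = 0" for C l
    using orth_proj_perp[OF subspace_qgraph[of r C], of z]
    unfolding orthogonal_comp_def orthogonal_def qgraph_def by (auto simp: inner_commute)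
  have step: "\<bar>inner (z - ?p C) (?g A l - ?g B l)\<bar> \<le> (1 + \<bar>r\<bar>)\<^sup>2 * norm (A - B) * (norm z)\<^sup>2"
    if "norm l \<le> (1 + \<bar>r\<bar>) * norm z" for C l
  proof -
    have "norm (?g A l - ?g B l) \<le> (1 + \<bar>r\<bar>) * norm (A - B) * ((1 + \<bar>r\<bar>) * norm z)"
      using gdiff[of l] mult_left_mono[OF that, of "(1 + \<bar>r\<bar>) * norm (A - B)"] by simp
    then have "norm (z - ?p C) * norm (?g A l - ?g B l) \<le> norm z * ((1 + \<bar>r\<bar>) * norm (A - B) * ((1 + \<bar>r\<bar>) * norm z))"
      by (intro mult_mono orth_proj_norm_le subspace_qgraph) auto
    then show ?thesis
      using Cauchy_Schwarz_ineq2[of "z - ?p C" "?g A l - ?g B l"]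
      by (simp add: power2_eq_square mult_ac)
  qed
  have "(norm (?p A - ?p B))\<^sup>2 = inner (z - ?p B) (?p A - ?p B) - inner (z - ?p A) (?p A - ?p B)"
    by (simp add: power2_norm_eq_inner inner_diff)
  also have "\<dots> = inner (z - ?p B) (?g A h - ?g B h) - inner (z - ?p A) (?g A k - ?g B k)"
  proof -
    have "inner (z - ?p B) (?p A - ?p B) = inner (z - ?p B) (?g A h - ?g B h)"
      using perp[of B h] perp[of B k] unfolding h(1) k(1) by (simp only: inner_diff_right)
    moreover have "inner (z - ?p A) (?p A - ?p B) = inner (z - ?p A) (?g A k - ?g B k)"
      using perp[of A h] perp[of A k] unfolding h(1) k(1) by (simp only: inner_diff_right)
    ultimately show ?thesis by simp
  qed
  also have "\<dots> \<le> 2 * (1 + \<bar>r\<bar>)\<^sup>2 * norm (A - B) * (norm z)\<^sup>2"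
    using step[OF h(2), of B] step[OF k(2), of A] by linarith
  finally have "norm (?p A - ?p B) \<le> sqrt (2 * (1 + \<bar>r\<bar>)\<^sup>2 * norm (A - B) * (norm z)\<^sup>2)"
    by (rule real_le_rsqrt)
  then show "norm (?p A - ?p B) \<le> sqrt (2 * (1 + \<bar>r\<bar>)\<^sup>2 * norm (A - B)) * norm z"
    by (simp add: real_sqrt_mult)
qed simp

lemma dist_Z_qgraph_tendsto:
  assumes "B \<longlonglongrightarrow> A"
  shows "(\<lambda>k. dist_Z (qgraph r A) (qgraph r (B k))) \<longlonglongrightarrow> 0"
proof (rule real_tendsto_sandwich[OF _ _ tendsto_const])
  have "(\<lambda>k. sqrt (2 * (1 + \<bar>r\<bar>)\<^sup>2 * norm (A - B k))) \<longlonglongrightarrow> sqrt (2 * (1 + \<bar>r\<bar>)\<^sup>2 * norm (A - A))"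
    using assms by (intro tendsto_intros)
  then show "(\<lambda>k. sqrt (2 * (1 + \<bar>r\<bar>)\<^sup>2 * norm (A - B k))) \<longlonglongrightarrow> 0" by simp
qed (auto intro: always_eventually dist_Z_qgraph_le dist_Z_nonneg subspace_qgraph)

section \<open>Minty parametrization of the subgradient graph\<close>

text \<open>
  Minty's parametrization: near the reference pair, \<open>(x, v)\<close> is a subgradient pair iff
  \<open>x = P z\<close> for \<open>z = (\<rho> + 1) *\<^sub>R x + v\<close>.
\<close>

locale prox_chart =
  fixes q :: "'a::euclidean_space \<Rightarrow> ereal" and \<rho> :: real
    and U :: "'a set" and W :: "('a \<times> 'a) set" and Z :: "'a set" and P :: "'a \<Rightarrow> 'a"
  assumes open_U: "open U" and open_W: "open W" and open_Z: "open Z" and rho: "0 \<le> \<rho>"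
    and W_U: "\<And>x v. (x, v) \<in> W \<Longrightarrow> x \<in> U"
    and subgradient_ineq: "\<And>x v y. (x, v) \<in> gph (subdiff q) \<inter> W \<Longrightarrow> y \<in> U \<Longrightarrow>
          q x + ereal (inner v (y - x) - \<rho> / 2 * (norm (y - x))\<^sup>2) \<le> q y"
    and P_mem: "\<And>z. z \<in> Z \<Longrightarrow> (P z, z - (\<rho> + 1) *\<^sub>R P z) \<in> gph (subdiff q) \<inter> W"
begin

abbreviation r where "r \<equiv> \<rho> + 1"

text \<open>The local conjugate of \<open>q + r / 2 * (norm _)\<^sup>2\<close>; its gradient is \<open>P\<close>.\<close>

definition potential :: "'a \<Rightarrow> real" where
  "potential z = inner z (P z) - real_of_ereal (q (P z)) - r / 2 * (norm (P z))\<^sup>2"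

section \<open>Monotonicity of the subgradient graph and the convex potential\<close>

lemma gph_finite: "(x, v) \<in> gph (subdiff q) \<Longrightarrow> q x = ereal (real_of_ereal (q x))"
  by (auto simp: gph_def subdiff_def ereal_real)

lemma P_in_U: "z \<in> Z \<Longrightarrow> P z \<in> U"
  using P_mem W_U by blast

text \<open>Adding the subgradient inequalities at both points cancels the values of
  \<open>q\<close> and leaves monotonicity up to \<open>\<rho>\<close> times the squared distance;
  the shift by \<open>r = \<rho> + 1\<close> compensates this and leaves the constant 1.\<close>

lemma strongly_monotone:
  assumes x: "(x, v) \<in> gph (subdiff q) \<inter> W" and y: "(y, u) \<in> gph (subdiff q) \<inter> W"
  shows "(norm (x - y))\<^sup>2 \<le> inner ((r *\<^sub>R x + v) - (r *\<^sub>R y + u)) (x - y)"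
proof -
  obtain a b where ab: "q x = ereal a" "q y = ereal b"
    using gph_finite x y by blast
  have "a + (inner v (y - x) - \<rho> / 2 * (norm (y - x))\<^sup>2) \<le> b"
    using subgradient_ineq[OF x, of y] W_U y ab by auto
  moreover have "b + (inner u (x - y) - \<rho> / 2 * (norm (x - y))\<^sup>2) \<le> a"
    using subgradient_ineq[OF y, of x] W_U x ab by auto
  ultimately have "inner v (y - x) + inner u (x - y) \<le> \<rho> * (norm (x - y))\<^sup>2"
    by (simp add: norm_minus_commute)
  then show ?thesis
    by (simp add: power2_norm_eq_inner inner_diff inner_add inner_commute algebra_simps)
qed

lemma P_unique:
  assumes "(x, v) \<in> gph (subdiff q) \<inter> W" "r *\<^sub>R x + v \<in> Z"
  shows "P (r *\<^sub>R x + v) = x"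
proof -
  have "(norm (x - P (r *\<^sub>R x + v)))\<^sup>2 \<le> 0"
    using strongly_monotone[OF assms(1) P_mem[OF assms(2)]] by simp
  then show ?thesis by simp
qed

lemma P_firm:
  assumes "z \<in> Z" "z' \<in> Z"
  shows "(norm (P z - P z'))\<^sup>2 \<le> inner (z - z') (P z - P z')"
  using strongly_monotone[OF P_mem P_mem, OF assms] by simp

lemma P_lipschitz:
  assumes "z \<in> Z" "z' \<in> Z"
  shows "norm (P z - P z') \<le> norm (z - z')"
proof -
  have "(norm (P z - P z'))\<^sup>2 \<le> norm (z - z') * norm (P z - P z')"
    using P_firm[OF assms] norm_cauchy_schwarz order_trans by blast
  then show ?thesis
    by (cases "norm (P z - P z') = 0") (simp_all add: power2_eq_square)
qed

lemma potential_eq: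
  assumes "z \<in> Z"
  shows "q (P z) = ereal (inner z (P z) - potential z - r / 2 * (norm (P z))\<^sup>2)"
  using gph_finite[OF IntD1[OF P_mem[OF assms]]] by (simp add: potential_def)

text \<open>The inequality at \<open>P z\<close> has constant \<open>\<rho>\<close> whereas the
  conjugate is taken with \<open>r\<close>, so completing the square leaves the surplus
  \<open>1 / 2 * (norm (y - P z))^2\<close>. Thus \<open>P z\<close> attains the supremum over
  \<open>U\<close> that defines the conjugate at \<open>z\<close>.\<close>

lemma potential_fenchel:
  assumes z: "z \<in> Z" and y: "y \<in> U" and le: "q y \<le> ereal \<beta>"
  shows "inner z y - potential z - r / 2 * (norm y)\<^sup>2 \<le> \<beta>"
proof -
  let ?x = "P z"
  have "ereal (inner z ?x - potential z - r / 2 * (norm ?x)\<^sup>2)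
      + ereal (inner (z - r *\<^sub>R ?x) (y - ?x) - \<rho> / 2 * (norm (y - ?x))\<^sup>2) \<le> ereal \<beta>"
    using subgradient_ineq[OF P_mem[OF z] y] le unfolding potential_eq[OF z] by (rule order_trans)
  then have "inner z ?x - potential z - r / 2 * (norm ?x)\<^sup>2
      + (inner (z - r *\<^sub>R ?x) (y - ?x) - \<rho> / 2 * (norm (y - ?x))\<^sup>2) \<le> \<beta>" by simp
  moreover have "inner z ?x - potential z - r / 2 * (norm ?x)\<^sup>2
      + (inner (z - r *\<^sub>R ?x) (y - ?x) - \<rho> / 2 * (norm (y - ?x))\<^sup>2)
      = inner z y - potential z - r / 2 * (norm y)\<^sup>2 + 1 / 2 * (norm (y - ?x))\<^sup>2"
    by (simp add: power2_norm_eq_inner inner_diff inner_add inner_commute field_simps)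
  ultimately show ?thesis
    using zero_le_power2[of "norm (y - ?x)"] by linarith
qed

text \<open>Fenchel's inequality for \<open>z'\<close> at the point \<open>P z\<close>, where
  equality holds for \<open>z\<close>. So \<open>P z\<close> is a subgradient of
  \<open>potential\<close> at \<open>z\<close>.\<close>

lemma potential_subgradient:
  assumes "z \<in> Z" "z' \<in> Z"
  shows "inner (z' - z) (P z) \<le> potential z' - potential z"
  using potential_fenchel[OF assms(2) P_in_U[OF assms(1)]] potential_eq[OF assms(1)]
  by (fastforce simp: inner_diff)

section \<open>Expansions of the potential along lines\<close>

lemma line_in_Z:
  assumes "z \<in> Z" "(t \<longlongrightarrow> 0) F" "(h \<longlongrightarrow> l) F"
  shows "\<forall>\<^sub>F i in F. z + t i *\<^sub>R h i \<in> Z"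
proof -
  have "((\<lambda>i. z + t i *\<^sub>R h i) \<longlongrightarrow> z + 0 *\<^sub>R l) F"
    using assms by (intro tendsto_intros)
  then show ?thesis using open_Z assms(1) topological_tendstoD by fastforce
qed

text \<open>The subgradient inequalities at both ends trap the remainder between 0 and the product
  of the step with the increment of \<open>P\<close>, which is quadratic in \<open>d\<close> because
  \<open>P\<close> is Lipschitz.\<close>

lemma potential_has_derivative:
  assumes "z + s *\<^sub>R h \<in> Z"
  shows "((\<lambda>s. potential (z + s *\<^sub>R h)) has_real_derivative inner (P (z + s *\<^sub>R h)) h) (at s)"
proof -
  let ?a = "z + s *\<^sub>R h"
  have ev: "\<forall>\<^sub>F d in at 0. ?a + d *\<^sub>R h \<in> Z"
    using line_in_Z[OF assms tendsto_ident_at tendsto_const] by blast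
  have "((\<lambda>d. (potential (?a + d *\<^sub>R h) - potential ?a) / d - inner (P ?a) h) \<longlongrightarrow> 0) (at 0)"
  proof (rule Lim_null_comparison)
    have "((\<lambda>d. \<bar>d\<bar> * (norm h)\<^sup>2) \<longlongrightarrow> \<bar>0\<bar> * (norm h)\<^sup>2) (at (0::real))"
      by (intro tendsto_intros)
    then show "((\<lambda>d::real. \<bar>d\<bar> * (norm h)\<^sup>2) \<longlongrightarrow> 0) (at 0)" by simp
    show "\<forall>\<^sub>F d in at 0. norm ((potential (?a + d *\<^sub>R h) - potential ?a) / d - inner (P ?a) h) \<le> \<bar>d\<bar> * (norm h)\<^sup>2"
      using ev eventually_neq_at_within[of 0 0 UNIV]
    proof eventually_elim
      case (elim d)
      define e where "e = potential (?a + d *\<^sub>R h) - potential ?a - d * inner (P ?a) h"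
      have e0: "0 \<le> e"
        using potential_subgradient[OF assms elim(1)] by (simp add: e_def inner_commute)
      have "potential (?a + d *\<^sub>R h) - potential ?a \<le> inner (d *\<^sub>R h) (P (?a + d *\<^sub>R h))"
        using potential_subgradient[OF elim(1) assms] by simp
      then have "e \<le> inner (d *\<^sub>R h) (P (?a + d *\<^sub>R h) - P ?a)"
        by (simp add: e_def inner_diff inner_commute algebra_simps)
      also have "\<dots> \<le> norm (d *\<^sub>R h) * norm (P (?a + d *\<^sub>R h) - P ?a)"
        by (rule norm_cauchy_schwarz)
      also have "\<dots> \<le> norm (d *\<^sub>R h) * norm (d *\<^sub>R h)"
        using P_lipschitz[OF elim(1) assms] by (intro mult_left_mono) auto
      also have "\<dots> = \<bar>d\<bar> * (\<bar>d\<bar> * (norm h)\<^sup>2)" by (simp add: power2_eq_square)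
      finally have "e / \<bar>d\<bar> \<le> \<bar>d\<bar> * (norm h)\<^sup>2"
        using elim(2) by (simp add: field_simps)
      moreover have "(potential (?a + d *\<^sub>R h) - potential ?a) / d - inner (P ?a) h = e / d"
        using elim(2) by (simp add: e_def field_simps)
      ultimately show ?case using e0 by (simp add: abs_divide)
    qed
  qed
  then have "((\<lambda>d. (potential (?a + d *\<^sub>R h) - potential ?a) / d) \<longlongrightarrow> inner (P ?a) h) (at 0)"
    by (rule LIM_zero_cancel)
  then show ?thesis
    unfolding DERIV_def by (simp add: scaleR_add_left add.assoc)
qed

text \<open>One-sided directional limits with a bounded linear limit map. As \<open>P\<close> is
  Lipschitz on the open set \<open>Z\<close> and the dimension is finite, for \<open>z\<close> in
  \<open>Z\<close> this is Frechet differentiability.\<close>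

definition chart_deriv :: "'a \<Rightarrow> ('a \<Rightarrow>\<^sub>L 'a) \<Rightarrow> bool" where
  "chart_deriv z A \<longleftrightarrow> (\<forall>h. ((\<lambda>t. (P (z + t *\<^sub>R h) - P z) /\<^sub>R t) \<longlongrightarrow> A h) (at_right 0))"

text \<open>The gradient \<open>P\<close> is assumed differentiable only at \<open>z\<close>, so the
  mean value theorem is applied to the remainder \<open>?u\<close>: its derivative at
  \<open>s\<close> is \<open>s\<close> times the error of the difference quotient of
  \<open>P\<close>, tested against \<open>h\<close>.\<close>

lemma potential_expansion:
  assumes z: "z \<in> Z" and A: "chart_deriv z A"
  shows "((\<lambda>t. (potential (z + t *\<^sub>R h) - potential z - t * inner (P z) h) / (1 / 2 * t\<^sup>2)) \<longlongrightarrow> inner (A h) h) (at_right 0)"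
proof -
  let ?u = "\<lambda>s. potential (z + s *\<^sub>R h) - potential z - s * inner (P z) h - 1 / 2 * s\<^sup>2 * inner (A h) h"
  have "((\<lambda>t. inner ((P (z + t *\<^sub>R h) - P z) /\<^sub>R t - A h) h) \<longlongrightarrow> inner (A h - A h) h) (at_right 0)"
    using A unfolding chart_deriv_def by (intro tendsto_intros) blast
  then have lim: "((\<lambda>t. inner ((P (z + t *\<^sub>R h) - P z) /\<^sub>R t - A h) h) \<longlongrightarrow> 0) (at_right 0)" by simp
  have inZ: "\<forall>\<^sub>F t in at_right 0. z + t *\<^sub>R h \<in> Z"
    by (rule line_in_Z[OF z tendsto_ident_at tendsto_const])
  show ?thesis
  proof (rule LIM_zero_cancel, rule tendstoI)
    fix e :: real assume e: "e > 0"
    have "\<forall>\<^sub>F t in at_right 0. \<bar>inner ((P (z + t *\<^sub>R h) - P z) /\<^sub>R t - A h) h\<bar> < e / 2"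
      using tendstoD[OF lim, of "e/2"] e by (simp add: dist_real_def)
    with inZ have "\<forall>\<^sub>F t in at_right 0. z + t *\<^sub>R h \<in> Z \<and> \<bar>inner ((P (z + t *\<^sub>R h) - P z) /\<^sub>R t - A h) h\<bar> < e / 2"
      by eventually_elim simp
    then obtain b where b: "b > 0" and near: "\<And>t. 0 < t \<Longrightarrow> t < b \<Longrightarrow>
        z + t *\<^sub>R h \<in> Z \<and> \<bar>inner ((P (z + t *\<^sub>R h) - P z) /\<^sub>R t - A h) h\<bar> < e / 2"
      by (auto simp: eventually_at_right_field)
    have "\<bar>?u t / (1 / 2 * t\<^sup>2)\<bar> < e" if t: "0 < t" "t < b" for t
    proof -
      have "\<exists>s>0. s < t \<and> ?u t - ?u 0 = (t - 0) * (inner (P (z + s *\<^sub>R h)) h - inner (P z) h - s * inner (A h) h)"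
      proof (rule MVT2)
        fix s assume "0 \<le> s" "s \<le> t"
        then have "z + s *\<^sub>R h \<in> Z" using near[of s] t z by (cases "s = 0") auto
        then show "(?u has_real_derivative inner (P (z + s *\<^sub>R h)) h - inner (P z) h - s * inner (A h) h) (at s)"
          by (auto intro!: derivative_eq_intros potential_has_derivative simp: power2_eq_square)
      qed (use t in auto)
      then obtain s where s: "0 < s" "s < t"
        "?u t = t * (inner (P (z + s *\<^sub>R h)) h - inner (P z) h - s * inner (A h) h)" by auto
      have eq: "inner (P (z + s *\<^sub>R h)) h - inner (P z) h - s * inner (A h) h
          = s * inner ((P (z + s *\<^sub>R h) - P z) /\<^sub>R s - A h) h"
        using s(1) by (simp add: inner_diff_left right_diff_distrib mult.assoc[symmetric])
      have "\<bar>?u t\<bar> = t * (s * \<bar>inner ((P (z + s *\<^sub>R h) - P z) /\<^sub>R s - A h) h\<bar>)"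
        unfolding s(3) eq using s t by (simp add: abs_mult)
      also have "\<dots> < t * (t * (e / 2))"
        using near[of s] s t e by (intro mult_strict_left_mono mult_strict_mono) auto
      finally show ?thesis using t by (simp add: power2_eq_square field_simps)
    qed
    moreover have "(potential (z + t *\<^sub>R h) - potential z - t * inner (P z) h) / (1 / 2 * t\<^sup>2) - inner (A h) h
        = ?u t / (1 / 2 * t\<^sup>2)" if "t > 0" for t
      using that by (simp add: field_simps)
    ultimately show "\<forall>\<^sub>F t in at_right 0. dist ((potential (z + t *\<^sub>R h) - potential z - t * inner (P z) h)
        / (1 / 2 * t\<^sup>2) - inner (A h) h) 0 < e"
      unfolding eventually_at_right_field using b by (intro exI[of _ b]) (simp add: dist_real_def)
  qed
qed

text \<open>Firm nonexpansiveness survives the limit of difference quotients. Symmetry reflects that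
  \<open>P\<close> is a gradient: \<open>2 *\<^sub>R A h\<close> is a subgradient at
  \<open>h\<close> of the quadratic form obtained from the expansion of
  \<open>potential\<close>.\<close>

lemma chart_deriv_firm_selfadjoint:
  assumes z: "z \<in> Z" and A: "chart_deriv z A"
  shows "firm_selfadjoint A"
proof -
  let ?D = "\<lambda>t h. (P (z + t *\<^sub>R h) - P z) /\<^sub>R t"
  let ?E = "\<lambda>t h. (potential (z + t *\<^sub>R h) - potential z - t * inner (P z) h) / (1 / 2 * t\<^sup>2)"
  have D: "((\<lambda>t. ?D t h) \<longlongrightarrow> A h) (at_right 0)" for h
    using A by (simp add: chart_deriv_def)
  have inZ: "\<forall>\<^sub>F t in at_right 0. z + t *\<^sub>R h \<in> Z" for h
    by (rule line_in_Z[OF z tendsto_ident_at tendsto_const])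
  have pos: "\<forall>\<^sub>F t in at_right (0::real). t > 0"
    by (simp add: eventually_at_right_less)
  have "(norm (A h))\<^sup>2 \<le> inner (A h) h" for h
  proof (rule tendsto_le[OF trivial_limit_at_right_real])
    show "((\<lambda>t. (norm (?D t h))\<^sup>2) \<longlongrightarrow> (norm (A h))\<^sup>2) (at_right 0)"
      by (intro tendsto_power tendsto_norm D)
    show "((\<lambda>t. inner (?D t h) h) \<longlongrightarrow> inner (A h) h) (at_right 0)"
      by (intro tendsto_inner tendsto_const D)
    show "\<forall>\<^sub>F t in at_right 0. (norm (?D t h))\<^sup>2 \<le> inner (?D t h) h"
      using inZ[of h] pos
    proof eventually_elim
      case (elim t)
      have "(norm (P (z + t *\<^sub>R h) - P z))\<^sup>2 \<le> t * inner h (P (z + t *\<^sub>R h) - P z)"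
        using P_firm[OF elim(1) z] by simp
      from this have "(norm (P (z + t *\<^sub>R h) - P z))\<^sup>2 / t\<^sup>2 \<le> t * inner h (P (z + t *\<^sub>R h) - P z) / t\<^sup>2"
        by (rule divide_right_mono) simp
      also have "\<dots> = inner (?D t h) h"
        using elim(2) by (simp add: power2_eq_square inner_commute divide_inverse)
      also have "(norm (P (z + t *\<^sub>R h) - P z))\<^sup>2 / t\<^sup>2 = (norm (?D t h))\<^sup>2"
        using elim(2) by (simp add: power_mult_distrib divide_inverse_commute power_inverse)
      finally show ?case .
    qed
  qed
  \<comment> \<open>Subgradient inequality of the second-order expansion; it forces symmetry by taking
    \<open>h' = h + s *\<^sub>R k\<close> and \<open>s \<rightarrow> 0\<close>.\<close>
  moreover have sub: "2 * inner (h' - h) (A h) \<le> inner (A h') h' - inner (A h) h" for h h'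
  proof (rule tendsto_le[OF trivial_limit_at_right_real])
    show "((\<lambda>t. ?E t h' - ?E t h) \<longlongrightarrow> inner (A h') h' - inner (A h) h) (at_right 0)"
      by (intro tendsto_diff potential_expansion z A)
    show "((\<lambda>t. 2 * inner (h' - h) (?D t h)) \<longlongrightarrow> 2 * inner (h' - h) (A h)) (at_right 0)"
      by (intro tendsto_mult tendsto_inner tendsto_const D)
    show "\<forall>\<^sub>F t in at_right 0. 2 * inner (h' - h) (?D t h) \<le> ?E t h' - ?E t h"
      using inZ[of h] inZ[of h'] pos
    proof eventually_elim
      case (elim t)
      have "t * inner (h' - h) (P (z + t *\<^sub>R h)) \<le> potential (z + t *\<^sub>R h') - potential (z + t *\<^sub>R h)"
        using potential_subgradient[OF elim(1,2)] by (simp add: inner_diff algebra_simps)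
      then have "t * inner (h' - h) (P (z + t *\<^sub>R h) - P z) \<le>
          (potential (z + t *\<^sub>R h') - potential z - t * inner (P z) h') - (potential (z + t *\<^sub>R h) - potential z - t * inner (P z) h)"
        by (simp add: inner_diff inner_commute algebra_simps)
      then have "t * inner (h' - h) (P (z + t *\<^sub>R h) - P z) / (1 / 2 * t\<^sup>2) \<le> ?E t h' - ?E t h"
        unfolding diff_divide_distrib[symmetric] by (rule divide_right_mono) simp
      moreover have "t * inner (h' - h) (P (z + t *\<^sub>R h) - P z) / (1 / 2 * t\<^sup>2) = 2 * inner (h' - h) (?D t h)"
        unfolding inner_scaleR_right using elim(3) by (simp add: power2_eq_square field_simps)
      ultimately show ?case by simp
    qed
  qed
  have "inner (A h) k \<le> inner (A k) h" for h k
  proof -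
    have "inner (A h) k - inner (A k) h \<le> s * inner (A k) k" if "s > 0" for s
    proof -
      have "s * (inner (A h) k - inner (A k) h) \<le> s * (s * inner (A k) k)"
        using sub[of "h + s *\<^sub>R k" h]
        by (simp add: blinfun.add_right blinfun.scaleR_right inner_add inner_commute algebra_simps)
      then show ?thesis using that by simp
    qed
    then have "\<forall>\<^sub>F s in at_right 0. inner (A h) k - inner (A k) h \<le> s * inner (A k) k"
      using pos by (simp add: eventually_mono)
    moreover have "((\<lambda>s. s * inner (A k) k) \<longlongrightarrow> 0 * inner (A k) k) (at_right 0)"
      by (intro tendsto_intros)
    ultimately have "inner (A h) k - inner (A k) h \<le> 0 * inner (A k) k"
      by (intro tendsto_lowerbound[OF _ _ trivial_limit_at_right_real])
    then show ?thesis by simp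
  qed
  then have "inner (A h) k = inner (A k) h" for h k by (meson antisym)
  ultimately show ?thesis by (simp add: firm_selfadjoint_def)
qed

section \<open>The tangent cone at a point of differentiability\<close>

lemma in_Z_W:
  assumes "(x, v) \<in> W" "r *\<^sub>R x + v \<in> Z" "t \<longlonglongrightarrow> 0" "a \<longlonglongrightarrow> l" "b \<longlonglongrightarrow> m"
  shows "\<forall>\<^sub>F k in sequentially. (x + t k *\<^sub>R a k, v + t k *\<^sub>R b k) \<in> W \<and>
    r *\<^sub>R (x + t k *\<^sub>R a k) + (v + t k *\<^sub>R b k) \<in> Z"
proof -
  have "(\<lambda>k. (x + t k *\<^sub>R a k, v + t k *\<^sub>R b k)) \<longlonglongrightarrow> (x + 0 *\<^sub>R l, v + 0 *\<^sub>R m)"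
    using assms by (intro tendsto_intros)
  then have "\<forall>\<^sub>F k in sequentially. (x + t k *\<^sub>R a k, v + t k *\<^sub>R b k) \<in> W"
    using open_W assms(1) topological_tendstoD by fastforce
  moreover have "(\<lambda>k. r *\<^sub>R (x + t k *\<^sub>R a k) + (v + t k *\<^sub>R b k)) \<longlonglongrightarrow> r *\<^sub>R (x + 0 *\<^sub>R l) + (v + 0 *\<^sub>R m)"
    using assms by (intro tendsto_intros)
  then have "\<forall>\<^sub>F k in sequentially. r *\<^sub>R (x + t k *\<^sub>R a k) + (v + t k *\<^sub>R b k) \<in> Z"
    using open_Z assms(2) topological_tendstoD by fastforce
  ultimately show ?thesis by eventually_elim simp
qed

lemma P_quotient_mem:
  assumes "z \<in> Z" "z + t *\<^sub>R h \<in> Z" "t > 0"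
  shows "(P z, z - r *\<^sub>R P z) + t *\<^sub>R ((P (z + t *\<^sub>R h) - P z) /\<^sub>R t, h - r *\<^sub>R ((P (z + t *\<^sub>R h) - P z) /\<^sub>R t)) \<in> gph (subdiff q)"
proof -
  have "(P z, z - r *\<^sub>R P z) + t *\<^sub>R ((P (z + t *\<^sub>R h) - P z) /\<^sub>R t, h - r *\<^sub>R ((P (z + t *\<^sub>R h) - P z) /\<^sub>R t))
     = (P (z + t *\<^sub>R h), z + t *\<^sub>R h - r *\<^sub>R P (z + t *\<^sub>R h))"
    using assms(3) by (simp add: scaleR_diff_right algebra_simps)
  then show ?thesis using P_mem[OF assms(2)] by (simp only: Int_iff)
qed

text \<open>Difference quotients of \<open>P\<close> in direction \<open>h\<close> trace curves in
  the graph, which gives the elements of \<open>qgraph r A\<close>. Conversely, the points realizing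
  a tangent vector \<open>y\<close> are eventually values of \<open>P\<close> at arguments perturbed
  in a direction tending to \<open>l = r *\<^sub>R fst y + snd y\<close>; the Lipschitz bound
  compares them with the quotients in direction \<open>l\<close>.\<close>

lemma tangent_cone_eq_qgraph:
  assumes gph: "(x, v) \<in> gph (subdiff q) \<inter> W" and z: "r *\<^sub>R x + v \<in> Z" and A: "chart_deriv (r *\<^sub>R x + v) A"
  shows "tangent_cone (gph (subdiff q)) (x, v) = qgraph r A"
proof (intro set_eqI iffI)
  let ?z = "r *\<^sub>R x + v"
  have Pz: "P ?z = x" by (rule P_unique[OF gph z])
  let ?D = "\<lambda>t h. (P (?z + t *\<^sub>R h) - P ?z) /\<^sub>R t"
  have D: "((\<lambda>t. ?D t h) \<longlongrightarrow> A h) (at_right 0)" for h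
    using A by (simp add: chart_deriv_def)
  {
    fix y assume "y \<in> qgraph r A"
    then obtain h where y: "y = (A h, h - r *\<^sub>R A h)" by (auto simp: qgraph_def)
    show "y \<in> tangent_cone (gph (subdiff q)) (x, v)"
    proof (rule tangent_coneI)
      show "((\<lambda>t. (?D t h, h - r *\<^sub>R ?D t h)) \<longlongrightarrow> y) (at_right 0)"
        unfolding y by (intro tendsto_intros D)
      have "\<forall>\<^sub>F t in at_right 0. ?z + t *\<^sub>R h \<in> Z"
        by (rule line_in_Z[OF z tendsto_ident_at tendsto_const])
      then show "\<forall>\<^sub>F t in at_right 0. (x, v) + t *\<^sub>R (?D t h, h - r *\<^sub>R ?D t h) \<in> gph (subdiff q)"
        using eventually_at_right_less[of 0]
        by eventually_elim (use P_quotient_mem[OF z] Pz in simp)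
    qed
  }
  fix y assume "y \<in> tangent_cone (gph (subdiff q)) (x, v)"
  then obtain t w where t: "\<And>k::nat. t k > 0" "t \<longlonglongrightarrow> 0" and w: "w \<longlonglongrightarrow> y"
    and mem: "\<And>k. (x, v) + t k *\<^sub>R w k \<in> gph (subdiff q)"
    unfolding tangent_cone_def by blast
  define a b where "a k = fst (w k)" and "b k = snd (w k)" for k
  have lim: "a \<longlonglongrightarrow> fst y" "b \<longlonglongrightarrow> snd y"
    using w unfolding a_def b_def by (auto intro!: tendsto_intros)
  have mem': "(x + t k *\<^sub>R a k, v + t k *\<^sub>R b k) \<in> gph (subdiff q)" for k
    using mem[of k] by (cases "w k") (simp add: a_def b_def)
  define l where "l = r *\<^sub>R fst y + snd y"
  have hl: "(\<lambda>k. r *\<^sub>R a k + b k) \<longlonglongrightarrow> l"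
    unfolding l_def by (intro tendsto_intros lim)
  have lZ: "\<forall>\<^sub>F k in sequentially. ?z + t k *\<^sub>R l \<in> Z"
    by (rule line_in_Z[OF z t(2) tendsto_const])
  have "(\<lambda>k. a k - ?D (t k) l) \<longlonglongrightarrow> 0"
  proof (rule Lim_null_comparison)
    have "(\<lambda>k. norm ((r *\<^sub>R a k + b k) - l)) \<longlonglongrightarrow> norm (l - l)"
      by (intro tendsto_intros hl)
    then show "(\<lambda>k. norm ((r *\<^sub>R a k + b k) - l)) \<longlonglongrightarrow> 0" by simp
    show "\<forall>\<^sub>F k in sequentially. norm (a k - ?D (t k) l) \<le> norm ((r *\<^sub>R a k + b k) - l)"
      using lZ in_Z_W[OF _ z t(2) lim, OF IntD2[OF gph]]
    proof eventually_elim
      case (elim k)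
      let ?y = "r *\<^sub>R (x + t k *\<^sub>R a k) + (v + t k *\<^sub>R b k)"
      have "P ?y = x + t k *\<^sub>R a k"
        using P_unique mem' elim by blast
      then have "a k - ?D (t k) l = (P ?y - P (?z + t k *\<^sub>R l)) /\<^sub>R t k"
        using t(1)[of k] Pz by (simp add: algebra_simps)
      then have "norm (a k - ?D (t k) l) = norm (P ?y - P (?z + t k *\<^sub>R l)) / t k"
        using t(1)[of k] by (simp only: norm_scaleR) (simp add: divide_inverse_commute)
      also have "\<dots> \<le> norm (?y - (?z + t k *\<^sub>R l)) / t k"
        using t(1)[of k] by (intro divide_right_mono P_lipschitz elim(1) conjunct2[OF elim(2)]) simp
      also have "?y - (?z + t k *\<^sub>R l) = t k *\<^sub>R ((r *\<^sub>R a k + b k) - l)"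
        by (simp add: algebra_simps)
      finally show ?case using t(1)[of k] by simp
    qed
  qed
  moreover have "(\<lambda>k. ?D (t k) l) \<longlonglongrightarrow> A l"
    using filterlim_compose[OF D at_right_seq] t by blast
  ultimately have "(\<lambda>k. a k - ?D (t k) l + ?D (t k) l) \<longlonglongrightarrow> 0 + A l"
    by (rule tendsto_add)
  then have "fst y = A l"
    using LIMSEQ_unique lim(1) by simp blast
  then have "y = (A l, l - r *\<^sub>R A l)" by (cases y) (simp add: l_def)
  then show "y \<in> qgraph r A" by (auto simp: qgraph_def)
qed

end

text \<open>If a nonzero \<open>y\<close> in \<open>T\<close> were mapped to 0, subtracting
  multiples of \<open>y\<close> would show that the part of \<open>T\<close> orthogonal to
  \<open>y\<close>, of smaller dimension, already maps onto the whole space.\<close>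

lemma linear_inj_on_of_dim:
  fixes f :: "'a::euclidean_space \<Rightarrow> 'b::euclidean_space"
  assumes f: "linear f" and T: "subspace T" "dim T = DIM('b)" and surj: "f ` T = UNIV"
    and y: "y \<in> T" "f y = 0"
  shows "y = 0"
proof (rule ccontr)
  assume "y \<noteq> 0"
  define T' where "T' = T \<inter> {u. inner y u = 0}"
  have sub: "subspace T'"
    unfolding T'_def using subspace_inter[OF T(1) subspace_hyperplane] by simp
  have "y \<notin> T'" using \<open>y \<noteq> 0\<close> by (simp add: T'_def)
  moreover have "T' \<subseteq> T" by (auto simp: T'_def)
  ultimately have "T' \<subset> T" using y(1) by blast
  then have "dim T' < dim T"
    using sub T(1) by (intro dim_psubset) (metis span_eq_iff)
  moreover have "b \<in> f ` T'" for b
  proof -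
    obtain u where u: "u \<in> T" "f u = b" using surj by (metis UNIV_I imageE)
    let ?u = "u - (inner y u / inner y y) *\<^sub>R y"
    have "?u \<in> T'"
      using u y T(1) \<open>y \<noteq> 0\<close> by (simp add: T'_def subspace_diff subspace_scale inner_diff)
    moreover have "f ?u = b"
      using u y by (simp add: linear_diff[OF f] linear_scale[OF f])
    ultimately show ?thesis by blast
  qed
  then have "f ` T' = UNIV" by blast
  then have "DIM('b) \<le> dim T'"
    using dim_image_le[OF f, of T'] by simp
  ultimately show False using T(2) by simp
qed

section \<open>Differentiability from cluster points of difference quotients\<close>

context prox_chart
begin

lemma quotient_cluster:
  assumes z: "z \<in> Z" and t: "\<And>k::nat. t k > 0" "t \<longlonglongrightarrow> 0"
  obtains s w where "strict_mono s" "(\<lambda>k. (P (z + t (s k) *\<^sub>R h) - P z) /\<^sub>R t (s k)) \<longlonglongrightarrow> w"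
proof -
  let ?D = "\<lambda>k. (P (z + t k *\<^sub>R h) - P z) /\<^sub>R t k"
  obtain K where K: "\<And>k. k \<ge> K \<Longrightarrow> z + t k *\<^sub>R h \<in> Z"
    using line_in_Z[OF z t(2) tendsto_const[of h]] by (auto simp: eventually_sequentially)
  have "norm (?D (k + K)) \<le> norm h" for k
  proof -
    have "norm (P (z + t (k + K) *\<^sub>R h) - P z) \<le> t (k + K) * norm h"
      using P_lipschitz[OF K z, of "k + K"] t(1)[of "k + K"] by simp
    moreover have "norm (?D (k + K)) = norm (P (z + t (k + K) *\<^sub>R h) - P z) / t (k + K)"
      using t(1)[of "k + K"] by (simp add: divide_inverse_commute)
    ultimately show ?thesis
      using t(1)[of "k + K"] by (simp add: pos_divide_le_eq mult.commute)
  qed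
  then have "bounded (range (\<lambda>k. ?D (k + K)))" by (auto simp: bounded_iff)
  then obtain w s where s: "strict_mono s" "((\<lambda>k. ?D (k + K)) \<circ> s) \<longlonglongrightarrow> w"
    using bounded_imp_convergent_subsequence by blast
  have "strict_mono (\<lambda>k. s k + K)" using s(1) by (simp add: strict_mono_def)
  then show thesis using that s(2) by (auto simp: o_def)
qed

text \<open>Shared criterion for the two converse directions. Two cluster points in the same
  direction differ by some \<open>w\<close> with \<open>(w, - r *\<^sub>R w)\<close> in
  \<open>S\<close>, so they coincide; linearity in \<open>h\<close> is inherited from
  \<open>S\<close>, and bounded quotients with a single cluster point converge.\<close>

lemma chart_deriv_exI:
  assumes z: "z \<in> Z" and S: "subspace S"
    and cluster: "\<And>h t w. (\<And>k::nat. t k > 0) \<Longrightarrow> t \<longlonglongrightarrow> 0 \<Longrightarrow>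
        (\<lambda>k. (P (z + t k *\<^sub>R h) - P z) /\<^sub>R t k) \<longlonglongrightarrow> w \<Longrightarrow> (w, h - r *\<^sub>R w) \<in> S"
    and unique: "\<And>w. (w, - r *\<^sub>R w) \<in> S \<Longrightarrow> w = 0"
  shows "\<exists>A. chart_deriv z A"
proof -
  let ?D = "\<lambda>t h. (P (z + t *\<^sub>R h) - P z) /\<^sub>R t"
  have uniq: "w = w'" if "(w, h - r *\<^sub>R w) \<in> S" "(w', h - r *\<^sub>R w') \<in> S" for w w' h
    using unique[of "w - w'"] subspace_diff[OF S that] by (simp add: algebra_simps)
  have "\<exists>w. (w, h - r *\<^sub>R w) \<in> S" for h
  proof -
    have t: "\<And>k. inverse (real (Suc k)) > 0" "(\<lambda>k. inverse (real (Suc k))) \<longlonglongrightarrow> 0"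
      using LIMSEQ_inverse_real_of_nat by auto
    obtain s w where s: "strict_mono s" "(\<lambda>k. ?D (inverse (real (Suc (s k)))) h) \<longlonglongrightarrow> w"
      using quotient_cluster[OF z t] by blast
    have "(w, h - r *\<^sub>R w) \<in> S"
      using cluster[OF _ _ s(2)] t(1) LIMSEQ_subseq_LIMSEQ[OF t(2) s(1)] by (simp add: o_def)
    then show ?thesis ..
  qed
  then obtain a where a: "\<And>h. (a h, h - r *\<^sub>R a h) \<in> S" by metis
  have "linear a"
  proof (rule linearI)
    show "a (h + k) = a h + a k" for h k
      using a[of "h + k"] subspace_add[OF S a a, of h k] by (intro uniq[of _ "h + k"]) (simp_all add: algebra_simps)
    show "a (c *\<^sub>R h) = c *\<^sub>R a h" for c h
      using a[of "c *\<^sub>R h"] subspace_scale[OF S a, of c h] by (intro uniq[of _ "c *\<^sub>R h"]) (simp_all add: algebra_simps)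
  qed
  then have bl: "bounded_linear a" by (simp add: linear_conv_bounded_linear)
  have "((\<lambda>t. ?D t h) \<longlongrightarrow> a h) (at_right 0)" for h
  proof (rule ccontr)
    assume "\<not> ?thesis"
    then obtain e where e: "e > 0" "\<not> (\<forall>\<^sub>F t in at_right 0. dist (?D t h) (a h) < e)"
      by (auto simp: tendsto_iff)
    have "\<exists>t>0. t < inverse (real (Suc k)) \<and> \<not> dist (?D t h) (a h) < e" for k
    proof (rule ccontr)
      assume "\<not> ?thesis"
      then have "\<exists>b>0. \<forall>t>0. t < b \<longrightarrow> dist (?D t h) (a h) < e"
        by (intro exI[of _ "inverse (real (Suc k))"]) auto
      with e(2) show False unfolding eventually_at_right_field by blast
    qed
    then obtain t where t: "\<And>k. t k > 0" "\<And>k. t k < inverse (real (Suc k))"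
      and far: "\<And>k. \<not> dist (?D (t k) h) (a h) < e" by metis
    have t0: "t \<longlonglongrightarrow> 0"
    proof (rule real_tendsto_sandwich[OF _ _ tendsto_const LIMSEQ_inverse_real_of_nat])
      show "\<forall>\<^sub>F k in sequentially. 0 \<le> t k" by (simp add: less_imp_le t(1))
      show "\<forall>\<^sub>F k in sequentially. t k \<le> inverse (real (Suc k))"
        using t(2) less_imp_le by (intro always_eventually) blast
    qed
    obtain s w where s: "strict_mono s" "(\<lambda>k. ?D (t (s k)) h) \<longlonglongrightarrow> w"
      using quotient_cluster[OF z t(1) t0] by blast
    have "(w, h - r *\<^sub>R w) \<in> S"
      using cluster[OF _ _ s(2)] t(1) LIMSEQ_subseq_LIMSEQ[OF t0 s(1)] by (simp add: o_def)
    then have "w = a h" using uniq a by blast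
    with s(2) have "\<forall>\<^sub>F k in sequentially. dist (?D (t (s k)) h) (a h) < e"
      using e(1) by (auto dest: tendstoD)
    with far show False by simp
  qed
  then show ?thesis
    unfolding chart_deriv_def using bounded_linear_Blinfun_apply[OF bl] by (intro exI[of _ "Blinfun a"]) simp
qed

text \<open>Here \<open>S\<close> is the tangent cone. Every direction \<open>h\<close> has a
  cluster point, so \<open>?f\<close> maps the cone onto the whole space; the dimension makes
  \<open>?f\<close> injective there, which is the uniqueness required of \<open>S\<close>.\<close>

lemma chart_deriv_of_tangent_cone:
  assumes gph: "(x, v) \<in> gph (subdiff q) \<inter> W" and z: "r *\<^sub>R x + v \<in> Z"
    and T: "tangent_cone (gph (subdiff q)) (x, v) \<in> Zspaces"
  shows "\<exists>A. chart_deriv (r *\<^sub>R x + v) A"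
proof (rule chart_deriv_exI[OF z])
  let ?T = "tangent_cone (gph (subdiff q)) (x, v)"
  let ?z = "r *\<^sub>R x + v"
  let ?D = "\<lambda>t h. (P (?z + t *\<^sub>R h) - P ?z) /\<^sub>R t"
  have Pz: "P ?z = x" by (rule P_unique[OF gph z])
  show sub: "subspace ?T" using T by (simp add: Zspaces_def)
  show clus: "(w, h - r *\<^sub>R w) \<in> ?T"
    if t: "\<And>k::nat. t k > 0" "t \<longlonglongrightarrow> 0" and w: "(\<lambda>k. ?D (t k) h) \<longlonglongrightarrow> w" for h t w
  proof (rule tangent_cone_seqI[OF t])
    show "(\<lambda>k. (?D (t k) h, h - r *\<^sub>R ?D (t k) h)) \<longlonglongrightarrow> (w, h - r *\<^sub>R w)"
      by (intro tendsto_intros w)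
    show "\<forall>\<^sub>F k in sequentially. (x, v) + t k *\<^sub>R (?D (t k) h, h - r *\<^sub>R ?D (t k) h) \<in> gph (subdiff q)"
      using line_in_Z[OF z t(2) tendsto_const[of h]]
    proof eventually_elim
      case (elim k)
      have "(x, v) = (P ?z, ?z - r *\<^sub>R P ?z)" by (simp add: Pz)
      then show ?case using P_quotient_mem[OF z elim t(1)] by (simp only:)
    qed
  qed
  let ?f = "\<lambda>y. r *\<^sub>R fst y + snd y"
  have "h \<in> ?f ` ?T" for h
  proof -
    have t: "\<And>k. inverse (real (Suc k)) > 0" "(\<lambda>k. inverse (real (Suc k))) \<longlonglongrightarrow> 0"
      using LIMSEQ_inverse_real_of_nat by auto
    obtain s w where s: "strict_mono s" "(\<lambda>k. ?D (inverse (real (Suc (s k)))) h) \<longlonglongrightarrow> w"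
      using quotient_cluster[OF z t] by blast
    have "(w, h - r *\<^sub>R w) \<in> ?T"
      using clus[OF _ _ s(2)] t(1) LIMSEQ_subseq_LIMSEQ[OF t(2) s(1)] by (simp add: o_def)
    then show ?thesis by (intro image_eqI[where x = "(w, h - r *\<^sub>R w)"]) simp_all
  qed
  then have surj: "?f ` ?T = UNIV" by blast
  have lin: "linear ?f"
    by (rule linearI) (simp_all add: algebra_simps)
  show "w = 0" if "(w, - r *\<^sub>R w) \<in> ?T" for w
  proof -
    have "?f (w, - r *\<^sub>R w) = 0" by (simp add: algebra_simps)
    from linear_inj_on_of_dim[OF lin sub _ surj that this] T show ?thesis
      by (simp add: Zspaces_def zero_prod_def)
  qed
qed

section \<open>Second-order quotients of \<open>q\<close> and of the potential\<close>

lemma line_in_U: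
  assumes "x \<in> U"
  shows "\<forall>\<^sub>F t in at_right 0. \<forall>w. norm w < R \<longrightarrow> x + t *\<^sub>R w \<in> U"
proof -
  obtain e where e: "e > 0" "ball x e \<subseteq> U" using open_U assms open_contains_ball by blast
  have "((\<lambda>t. t * \<bar>R\<bar>) \<longlongrightarrow> 0 * \<bar>R\<bar>) (at_right 0)" by (intro tendsto_intros)
  then have "\<forall>\<^sub>F t in at_right 0. t * \<bar>R\<bar> < e"
    using e(1) by (intro order_tendstoD(2)) auto
  then show ?thesis
    using eventually_at_right_less[of 0]
  proof eventually_elim
    case (elim t)
    have "x + t *\<^sub>R w \<in> ball x e" if "norm w < R" for w
    proof -
      have "t * norm w \<le> t * \<bar>R\<bar>" using that elim by (intro mult_left_mono) auto
      then have "t * norm w < e" using elim by linarith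
      then show ?thesis using elim by (simp add: dist_norm)
    qed
    then show ?case using e(2) by blast
  qed
qed

definition potential_quotient :: "'a \<Rightarrow> 'a \<Rightarrow> real \<Rightarrow> real" where
  "potential_quotient z h t = (potential (z + t *\<^sub>R h) - potential z - t * inner (P z) h) / (1 / 2 * t\<^sup>2)"

context
  fixes x v z
  assumes gph: "(x, v) \<in> gph (subdiff q) \<inter> W" and z: "z \<in> Z" and z_eq: "z = r *\<^sub>R x + v"
begin

lemma Pz: "P z = x" using P_unique[OF gph] z z_eq by simp

lemma x_U: "x \<in> U" using gph W_U by blast

lemma q_x: "q x = ereal (inner z x - potential z - r / 2 * (norm x)\<^sup>2)"
  using potential_eq[OF z] Pz by simp

lemma inner_z: "inner z y = r * inner x y + inner v y" "inner y z = r * inner x y + inner v y"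
  by (simp_all add: z_eq inner_add inner_commute)

text \<open>The subgradient inequality at \<open>x\<close> divided by \<open>t^2 / 2\<close>. The
  bound is uniform in \<open>t\<close>, so the second subderivative inherits it.\<close>

lemma second_quotient_lower:
  assumes "t > 0" "x + t *\<^sub>R w \<in> U" "second_quotient q x v t w \<le> ereal \<alpha>"
  shows "- \<rho> * (norm w)\<^sup>2 \<le> \<alpha>"
proof -
  have "q (x + t *\<^sub>R w) \<le> ereal (inner z x - potential z - r / 2 * (norm x)\<^sup>2 + t * inner v w + 1 / 2 * t\<^sup>2 * \<alpha>)"
    using assms(3) second_quotient_le_iff[where q = q and x = x, OF q_x assms(1)] by blast
  with subgradient_ineq[OF gph assms(2)]
  have "q x + ereal (inner v (t *\<^sub>R w) - \<rho> / 2 * (norm (t *\<^sub>R w))\<^sup>2)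
      \<le> ereal (inner z x - potential z - r / 2 * (norm x)\<^sup>2 + t * inner v w + 1 / 2 * t\<^sup>2 * \<alpha>)"
    by (auto intro: order_trans)
  then have "t\<^sup>2 * (- \<rho> * (norm w)\<^sup>2) \<le> t\<^sup>2 * \<alpha>"
    by (simp add: q_x power_mult_distrib mult_ac)
  then show ?thesis using assms(1) by (simp only: mult_le_cancel_left_pos zero_less_power)
qed

text \<open>Fenchel's inequality at \<open>z + t h\<close> and \<open>x + t w\<close>, with the
  zero- and first-order terms removed and the rest divided by \<open>t^2 / 2\<close>.\<close>

lemma second_quotient_fenchel:
  assumes "t > 0" "z + t *\<^sub>R h \<in> Z" "x + t *\<^sub>R w \<in> U" "second_quotient q x v t w \<le> ereal \<alpha>"
  shows "2 * inner h w - potential_quotient z h t - r * (norm w)\<^sup>2 \<le> \<alpha>"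
proof -
  let ?N = "potential (z + t *\<^sub>R h) - potential z - t * inner x h"
  have "q (x + t *\<^sub>R w) \<le> ereal (inner z x - potential z - r / 2 * (norm x)\<^sup>2 + t * inner v w + 1 / 2 * t\<^sup>2 * \<alpha>)"
    using assms(4) second_quotient_le_iff[where q = q and x = x, OF q_x assms(1)] by blast
  from potential_fenchel[OF assms(2,3) this]
  have le: "inner (z + t *\<^sub>R h) (x + t *\<^sub>R w) - potential (z + t *\<^sub>R h) - r / 2 * (norm (x + t *\<^sub>R w))\<^sup>2
      \<le> inner z x - potential z - r / 2 * (norm x)\<^sup>2 + t * inner v w + 1 / 2 * t\<^sup>2 * \<alpha>" .
  have "t\<^sup>2 * inner h w - ?N - r / 2 * t\<^sup>2 * (norm w)\<^sup>2
      = inner (z + t *\<^sub>R h) (x + t *\<^sub>R w) - potential (z + t *\<^sub>R h) - r / 2 * (norm (x + t *\<^sub>R w))\<^sup>2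
       - (inner z x - potential z - r / 2 * (norm x)\<^sup>2 + t * inner v w)"
    unfolding power2_norm_eq_inner
    by (simp add: inner_z inner_add inner_commute power2_eq_square field_simps)
  also have "\<dots> \<le> 1 / 2 * t\<^sup>2 * \<alpha>" using le by simp
  finally have "t\<^sup>2 * inner h w - ?N - r / 2 * t\<^sup>2 * (norm w)\<^sup>2 \<le> 1 / 2 * t\<^sup>2 * \<alpha>" .
  moreover have "2 * a - n / (1 / 2 * t\<^sup>2) - s * b \<le> \<alpha>"
    if "t\<^sup>2 * a - n - s / 2 * t\<^sup>2 * b \<le> 1 / 2 * t\<^sup>2 * \<alpha>" for a b n s
    using that assms(1) by (simp add: field_simps)
  ultimately show ?thesis
    unfolding potential_quotient_def Pz by blast
qed

text \<open>The case of equality in Fenchel's inequality, since here \<open>x + t w\<close> is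
  \<open>P (z + t h)\<close>. The direction stated is the one that gives membership in the
  epigraph.\<close>

lemma second_quotient_P:
  assumes "t > 0" "z + t *\<^sub>R h \<in> Z"
  defines "w \<equiv> (P (z + t *\<^sub>R h) - P z) /\<^sub>R t"
  shows "second_quotient q x v t w \<le> ereal (2 * inner h w - potential_quotient z h t - r * (norm w)\<^sup>2)"
proof -
  let ?N = "potential (z + t *\<^sub>R h) - potential z - t * inner x h"
  have xw: "x + t *\<^sub>R w = P (z + t *\<^sub>R h)" using assms(1) by (simp add: w_def Pz)
  have "1 / 2 * t\<^sup>2 * (2 * inner h w - potential_quotient z h t - r * (norm w)\<^sup>2)
      = t\<^sup>2 * inner h w - 1 / 2 * t\<^sup>2 * potential_quotient z h t - r / 2 * t\<^sup>2 * (norm w)\<^sup>2"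
    by (simp add: algebra_simps)
  also have "1 / 2 * t\<^sup>2 * potential_quotient z h t = ?N"
    using assms(1) by (simp add: potential_quotient_def Pz)
  finally have half: "1 / 2 * t\<^sup>2 * (2 * inner h w - potential_quotient z h t - r * (norm w)\<^sup>2)
      = t\<^sup>2 * inner h w - ?N - r / 2 * t\<^sup>2 * (norm w)\<^sup>2" .
  have "inner (z + t *\<^sub>R h) (x + t *\<^sub>R w) - potential (z + t *\<^sub>R h) - r / 2 * (norm (x + t *\<^sub>R w))\<^sup>2
      = inner z x - potential z - r / 2 * (norm x)\<^sup>2 + t * inner v w
        + 1 / 2 * t\<^sup>2 * (2 * inner h w - potential_quotient z h t - r * (norm w)\<^sup>2)"
    unfolding half
    unfolding power2_norm_eq_inner
    by (simp add: inner_z inner_add inner_commute power2_eq_square field_simps)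
  moreover have "q (x + t *\<^sub>R w) = ereal (inner (z + t *\<^sub>R h) (x + t *\<^sub>R w) - potential (z + t *\<^sub>R h)
      - r / 2 * (norm (x + t *\<^sub>R w))\<^sup>2)"
    using potential_eq[OF assms(2)] unfolding xw .
  ultimately show ?thesis
    unfolding second_quotient_le_iff[where q = q and x = x, OF q_x assms(1)] by simp
qed

lemma second_quotient_epi_converges:
  assumes A: "chart_deriv z A"
  shows "epi_converges (second_quotient q x v) (qform r A) (at_right 0)"
proof (rule epi_converges_qformI[OF chart_deriv_firm_selfadjoint[OF z A] trivial_limit_at_right_real,
      where c = "\<lambda>t h. potential_quotient z h t"])
  have inZ: "\<forall>\<^sub>F t in at_right 0. z + t *\<^sub>R h \<in> Z" for h
    by (rule line_in_Z[OF z tendsto_ident_at tendsto_const])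
  show E: "(potential_quotient z h \<longlongrightarrow> inner (A h) h) (at_right 0)" for h
    unfolding potential_quotient_def by (rule potential_expansion[OF z A])
  show "\<forall>\<^sub>F t in at_right 0. \<forall>w \<alpha>. norm w < R \<longrightarrow> second_quotient q x v t w \<le> ereal \<alpha> \<longrightarrow>
      2 * inner h w - potential_quotient z h t - r * (norm w)\<^sup>2 \<le> \<alpha>" for h R
    using inZ[of h] line_in_U[OF x_U, of R] eventually_at_right_less[of 0]
    by eventually_elim (use second_quotient_fenchel in blast)
  show "\<exists>y. (y \<longlongrightarrow> (A h, inner (A h) h - r * (norm (A h))\<^sup>2)) (at_right 0) \<and>
      (\<forall>\<^sub>F t in at_right 0. y t \<in> epi (second_quotient q x v t))" for h
  proof -
    let ?D = "\<lambda>t. (P (z + t *\<^sub>R h) - P z) /\<^sub>R t"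
    let ?y = "\<lambda>t. (?D t, 2 * inner h (?D t) - potential_quotient z h t - r * (norm (?D t))\<^sup>2)"
    have D: "(?D \<longlongrightarrow> A h) (at_right 0)" using A by (simp add: chart_deriv_def)
    have "(?y \<longlongrightarrow> (A h, 2 * inner h (A h) - inner (A h) h - r * (norm (A h))\<^sup>2)) (at_right 0)"
      by (intro tendsto_Pair tendsto_diff tendsto_mult tendsto_inner tendsto_power tendsto_norm tendsto_const D E)
    then have "(?y \<longlongrightarrow> (A h, inner (A h) h - r * (norm (A h))\<^sup>2)) (at_right 0)"
      by (simp add: inner_commute)
    moreover have "\<forall>\<^sub>F t in at_right 0. ?y t \<in> epi (second_quotient q x v t)"
      using inZ[of h] eventually_at_right_less[of 0]
      by eventually_elim (use second_quotient_P in \<open>simp add: epi_def\<close>)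
    ultimately show ?thesis by blast
  qed
qed

lemma chart_deriv_gtd:
  assumes A: "chart_deriv z A"
  shows "second_subderiv q x v = qform r A" "generalized_twice_differentiable q x v"
proof -
  note conv = second_quotient_epi_converges[OF A]
  show eq: "second_subderiv q x v = qform r A"
    using conv epi_second_subderiv[of q x v] unfolding epi_converges_def by (intro epi_inject) simp
  show "generalized_twice_differentiable q x v"
    unfolding generalized_twice_differentiable_def twice_epi_differentiable_def eq
    using gph conv q_x generalized_quadratic_form_qform[OF chart_deriv_firm_selfadjoint[OF z A]]
    by (simp add: gph_def)
qed

lemma chart_deriv_of_gtd:
  assumes gtd: "generalized_twice_differentiable q x v"
  shows "\<exists>A. chart_deriv z A"
proof -
  define \<phi> where "\<phi> = second_subderiv q x v"
  have conv: "outer_limit (\<lambda>t. epi (second_quotient q x v t)) (at_right 0) = epi \<phi>"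
    "inner_limit (\<lambda>t. epi (second_quotient q x v t)) (at_right 0) = epi \<phi>"
    and zero: "\<phi> 0 = 0" and sub: "subspace (gph (subdiff \<phi>))"
    using gtd unfolding generalized_twice_differentiable_def twice_epi_differentiable_def
      epi_converges_def generalized_quadratic_form_def \<phi>_def by auto
  \<comment> \<open>The uniform lower bound on the quotients passes to outer limits of their
    epigraphs.\<close>
  have lower: "- \<rho> * (norm w)\<^sup>2 \<le> \<alpha>" if mem: "(w, \<alpha>) \<in> epi \<phi>" for w \<alpha>
  proof (rule ccontr)
    assume neg: "\<not> ?thesis"
    let ?V = "{y. norm (fst y) < norm w + 1} \<inter> {y. snd y < - \<rho> * (norm (fst y))\<^sup>2}"
    have "open ?V" by (intro open_Int open_Collect_less continuous_intros)
    moreover have "(w, \<alpha>) \<in> ?V" using neg by simp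
    ultimately have fr: "\<exists>\<^sub>F t in at_right 0. epi (second_quotient q x v t) \<inter> ?V \<noteq> {}"
      using mem unfolding conv(1)[symmetric] outer_limit_def by blast
    have "\<forall>\<^sub>F t in at_right 0. epi (second_quotient q x v t) \<inter> ?V = {}"
      using line_in_U[OF x_U, of "norm w + 1"] eventually_at_right_less[of 0]
      by eventually_elim (use second_quotient_lower in \<open>fastforce simp: epi_def\<close>)
    with fr show False by (simp add: frequently_def)
  qed
  have hom: "(s *\<^sub>R w, s\<^sup>2 * \<alpha>) \<in> epi \<phi>" if s: "s > 0" "(w, \<alpha>) \<in> epi \<phi>" for s w \<alpha>
  proof -
    have "\<bar>q x\<bar> \<noteq> \<infinity>" by (simp add: q_x)
    from second_subderiv_homogeneous[where q = q and x = x, OF this s(1)] s(2) show ?thesis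
      unfolding \<phi>_def by blast
  qed
  let ?D = "\<lambda>t h. (P (z + t *\<^sub>R h) - P z) /\<^sub>R t"
  have cluster: "2 *\<^sub>R (h - r *\<^sub>R w) \<in> subdiff \<phi> w"
    if t: "\<And>k::nat. t k > 0" "t \<longlonglongrightarrow> 0" and w: "(\<lambda>k. ?D (t k) h) \<longlonglongrightarrow> w" for h t w
  proof -
    note tr = at_right_seq[OF t]
    \<comment> \<open>Rearranged, this says that \<open>w\<close> minimizes
      \<open>\<phi> + r |.|^2 - 2 <h, .>\<close>. The inner limit lets a competitor
      \<open>(y, \<alpha>)\<close> be approached along the same steps \<open>t k\<close>. Fenchel's
      inequality for it and the equality case for \<open>?D (t k) h\<close> share the term
      \<open>potential_quotient z h (t k)\<close>, which cancels.\<close>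
    have minimal: "(w, \<alpha> + r * (norm y)\<^sup>2 - 2 * inner h y - r * (norm w)\<^sup>2 + 2 * inner h w) \<in> epi \<phi>"
      if "(y, \<alpha>) \<in> epi \<phi>" for y \<alpha>
    proof -
      have "(y, \<alpha>) \<in> inner_limit (\<lambda>t. epi (second_quotient q x v t)) (at_right 0)"
        using that conv(2) by simp
      then obtain u where u: "u \<longlonglongrightarrow> (y, \<alpha>)" "\<forall>\<^sub>F k in sequentially. u k \<in> epi (second_quotient q x v (t k))"
        by (rule inner_limit_seqE[OF _ tr])
      have fu: "(\<lambda>k. fst (u k)) \<longlonglongrightarrow> y" and su: "(\<lambda>k. snd (u k)) \<longlonglongrightarrow> \<alpha>"
        using tendsto_fst[OF u(1)] tendsto_snd[OF u(1)] by simp_all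
      let ?\<beta> = "\<lambda>k. snd (u k) + r * (norm (fst (u k)))\<^sup>2 - 2 * inner h (fst (u k))
          - r * (norm (?D (t k) h))\<^sup>2 + 2 * inner h (?D (t k) h)"
      have "(\<lambda>k. x + t k *\<^sub>R fst (u k)) \<longlonglongrightarrow> x + 0 *\<^sub>R y"
        by (intro tendsto_intros t fu)
      then have uU: "\<forall>\<^sub>F k in sequentially. x + t k *\<^sub>R fst (u k) \<in> U"
        using open_U x_U topological_tendstoD by fastforce
      show ?thesis
        unfolding conv(1)[symmetric]
      proof (rule outer_limit_seqI[OF tr])
        show "(\<lambda>k. (?D (t k) h, ?\<beta> k)) \<longlonglongrightarrow>
            (w, \<alpha> + r * (norm y)\<^sup>2 - 2 * inner h y - r * (norm w)\<^sup>2 + 2 * inner h w)"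
          by (intro tendsto_Pair tendsto_add tendsto_diff tendsto_mult tendsto_inner tendsto_power
              tendsto_norm tendsto_const w fu su)
        show "\<forall>\<^sub>F k in sequentially. (?D (t k) h, ?\<beta> k) \<in> epi (second_quotient q x v (t k))"
          using uU u(2) line_in_Z[OF z t(2) tendsto_const[of h]]
        proof eventually_elim
          case (elim k)
          have "second_quotient q x v (t k) (fst (u k)) \<le> ereal (snd (u k))"
            using elim(2) by (simp add: epi_def case_prod_beta)
          from second_quotient_fenchel[OF t(1) elim(3) elim(1) this]
          have "ereal (2 * inner h (?D (t k) h) - potential_quotient z h (t k) - r * (norm (?D (t k) h))\<^sup>2) \<le> ereal (?\<beta> k)"
            unfolding ereal_less_eq(3) by linarith
          then show ?case
            unfolding epi_iff using second_quotient_P[OF t(1) elim(3)] by (rule order_trans[rotated])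
        qed
      qed
    qed
    have "(0, 0) \<in> epi \<phi>" using zero by (simp add: epi_def zero_ereal_def)
    from minimal[OF this] have "\<phi> w \<noteq> \<infinity>" by (auto simp: epi_def)
    moreover have "\<phi> w \<noteq> - \<infinity>"
      using lower[of w "- \<rho> * (norm w)\<^sup>2 - 1"] by (auto simp: epi_def)
    ultimately obtain m where m: "\<phi> w = ereal m" by (cases "\<phi> w") auto
    show ?thesis
    proof (rule proximal_subgradient[where U = UNIV and c = r])
      fix y
      show "\<phi> w + ereal (inner (2 *\<^sub>R (h - r *\<^sub>R w)) (y - w) - r * (norm (y - w))\<^sup>2) \<le> \<phi> y"
        unfolding m
      proof (rule ereal_le_real)
        fix \<alpha> assume "\<phi> y \<le> ereal \<alpha>"
        then have "m \<le> \<alpha> + r * (norm y)\<^sup>2 - 2 * inner h y - r * (norm w)\<^sup>2 + 2 * inner h w"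
          using minimal[of y \<alpha>] m by (simp add: epi_def)
        then have "m + (inner (2 *\<^sub>R (h - r *\<^sub>R w)) (y - w) - r * (norm (y - w))\<^sup>2) \<le> \<alpha>"
          by (simp add: power2_norm_eq_inner inner_diff inner_add inner_commute algebra_simps)
        then show "ereal m + ereal (inner (2 *\<^sub>R (h - r *\<^sub>R w)) (y - w) - r * (norm (y - w))\<^sup>2) \<le> ereal \<alpha>"
          by simp
      qed
    qed (use m in auto)
  qed
  \<comment> \<open>The subgradient of \<open>\<phi>\<close> found at \<open>w\<close> is twice
    \<open>h - r w\<close>; rescaling the second component absorbs the factor.\<close>
  let ?S = "(\<lambda>y. (fst y, 2 *\<^sub>R snd y)) -` gph (subdiff \<phi>)"
  show ?thesis
  proof (rule chart_deriv_exI[OF z])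
    have "linear (\<lambda>y :: 'a \<times> 'a. (fst y, 2 *\<^sub>R snd y))"
      by (rule linearI) (simp_all add: algebra_simps)
    then show "subspace ?S" by (rule linear_subspace_vimage[OF _ sub])
    show "(w, h - r *\<^sub>R w) \<in> ?S" if "\<And>k::nat. t k > 0" "t \<longlonglongrightarrow> 0" "(\<lambda>k. ?D (t k) h) \<longlonglongrightarrow> w" for h t w
      using cluster[OF that] by (simp add: gph_def)
    show "w = 0" if "(w, - r *\<^sub>R w) \<in> ?S" for w
    proof -
      have "2 *\<^sub>R (- r *\<^sub>R w) \<in> subdiff \<phi> w" using that by (simp add: gph_def)
      \<comment> \<open>Euler's identity gives the value \<open>- r |w|^2\<close>, which for
        \<open>r = \<rho> + 1\<close> falls below the bound \<open>- \<rho> |w|^2\<close> unless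
        \<open>w = 0\<close>.\<close>
      from subgradient_homogeneous[OF hom this]
      have "\<phi> w = ereal (- r * (norm w)\<^sup>2)" by (simp add: power2_norm_eq_inner)
      then have "- \<rho> * (norm w)\<^sup>2 \<le> - r * (norm w)\<^sup>2"
        by (intro lower) (simp add: epi_def)
      then have "(norm w)\<^sup>2 \<le> 0" by (simp add: algebra_simps)
      then show "w = 0" by simp
    qed
  qed
qed

end

end

section \<open>Existence of the parametrization\<close>

text \<open>Turns the sequential definition into a neighbourhood, so that the restriction on the
  values of \<open>q\<close> in prox-regularity is met at all subgradient pairs close to
  \<open>(xb, vb)\<close>.\<close>

lemma subgradient_values_near:
  assumes cont: "subdiff_continuous q xb vb" and "\<epsilon> > 0"
  shows "\<exists>\<eta>>0. \<forall>x v. (x, v) \<in> gph (subdiff q) \<longrightarrow> dist (x, v) (xb, vb) < \<eta> \<longrightarrow> \<bar>q x - q xb\<bar> \<le> ereal \<epsilon>"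
proof (rule ccontr)
  assume neg: "\<not> ?thesis"
  have "\<exists>p. p \<in> gph (subdiff q) \<and> dist p (xb, vb) < inverse (real (Suc k)) \<and> \<not> \<bar>q (fst p) - q xb\<bar> \<le> ereal \<epsilon>" for k
  proof (rule ccontr)
    assume "\<not> ?thesis"
    with neg show False
      by (metis fst_conv inverse_positive_iff_positive of_nat_0_less_iff zero_less_Suc)
  qed
  then obtain p where p: "\<And>k. p k \<in> gph (subdiff q)" "\<And>k. dist (p k) (xb, vb) < inverse (real (Suc k))"
    and far: "\<And>k. \<not> \<bar>q (fst (p k)) - q xb\<bar> \<le> ereal \<epsilon>" by metis
  have "p \<longlonglongrightarrow> (xb, vb)"
    by (rule metric_tendsto_imp_tendsto[OF LIMSEQ_inverse_real_of_nat])
      (use p(2) in \<open>auto intro!: always_eventually less_imp_le\<close>)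
  then have lim: "(\<lambda>k. q (fst (p k))) \<longlonglongrightarrow> q xb"
    using conjunct2[OF cont[unfolded subdiff_continuous_def], rule_format,
        of "\<lambda>k. fst (p k)" "\<lambda>k. snd (p k)"] p(1) by simp
  obtain \<mu> where \<mu>: "q xb = ereal \<mu>"
    using cont by (auto simp: subdiff_continuous_def subdiff_def)
  have "\<forall>\<^sub>F k in sequentially. ereal (\<mu> - \<epsilon>) < q (fst (p k)) \<and> q (fst (p k)) < ereal (\<mu> + \<epsilon>)"
    using order_tendstoD[OF lim] \<open>\<epsilon> > 0\<close> \<mu> by (intro eventually_conj) auto
  then obtain k where k: "ereal (\<mu> - \<epsilon>) < q (fst (p k))" "q (fst (p k)) < ereal (\<mu> + \<epsilon>)"
    using eventually_happens sequentially_bot by blast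
  then obtain a where "q (fst (p k)) = ereal a" by (cases "q (fst (p k))") auto
  with far[of k] k \<mu> show False by (simp add: abs_le_iff)
qed

text \<open>Prepares a minimization over pairs \<open>(y, \<alpha>)\<close>, where the objective is
  real-valued and continuous. Heights are capped at \<open>M\<close> because sublevel sets are known
  to be closed only up to that level.\<close>

lemma compact_truncated_epi:
  fixes q :: "'a::euclidean_space \<Rightarrow> ereal"
  assumes top: "\<And>\<alpha>. ereal \<alpha> \<le> ereal M \<Longrightarrow> closed {y \<in> cball x e. q y \<le> ereal \<alpha>}"
  shows "compact {(y, \<alpha>). y \<in> cball x e \<and> q y \<le> ereal \<alpha> \<and> m \<le> \<alpha> \<and> \<alpha> \<le> M}" (is "compact ?K")
proof -
  have "?K \<subseteq> cball x e \<times> {m..M}" by auto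
  then have "bounded ?K" by (rule bounded_subset[rotated]) (intro bounded_Times bounded_cball bounded_closed_interval)
  moreover have "closed ?K"
    unfolding closed_sequential_limits
  proof (intro allI impI)
    fix u l assume "(\<forall>n. u n \<in> ?K) \<and> u \<longlonglongrightarrow> l"
    then have u: "\<And>n. fst (u n) \<in> cball x e" "\<And>n. q (fst (u n)) \<le> ereal (snd (u n))"
        "\<And>n. m \<le> snd (u n)" "\<And>n. snd (u n) \<le> M"
      and "u \<longlonglongrightarrow> l" by (auto simp: case_prod_beta)
    then have lim: "(\<lambda>n. fst (u n)) \<longlonglongrightarrow> fst l" "(\<lambda>n. snd (u n)) \<longlonglongrightarrow> snd l"
      by (auto intro: tendsto_fst tendsto_snd)
    have "fst l \<in> cball x e"
      using closed_sequentially[OF closed_cball _ lim(1)] u(1) by blast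
    moreover have bds: "m \<le> snd l" "snd l \<le> M"
      using LIMSEQ_le_const[OF lim(2)] LIMSEQ_le_const2[OF lim(2)] u(3,4) by auto
    moreover have level: "q (fst l) \<le> ereal \<alpha>"
      if "\<alpha> \<le> M" "\<forall>\<^sub>F n in sequentially. snd (u n) \<le> \<alpha>" for \<alpha>
    proof -
      have "\<forall>\<^sub>F n in sequentially. fst (u n) \<in> {y \<in> cball x e. q y \<le> ereal \<alpha>}"
        using that(2)
      proof eventually_elim
        case (elim n)
        then have "q (fst (u n)) \<le> ereal \<alpha>" using u(2)[of n] by (meson ereal_less_eq(3) order_trans)
        then show ?case using u(1) by blast
      qed
      from Lim_in_closed_set[OF top this sequentially_bot lim(1)] that(1) show ?thesis by simp
    qed
    moreover have "q (fst l) \<le> ereal (snd l)"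
    proof (rule ccontr)
      assume "\<not> ?thesis"
      then obtain \<beta> where \<beta>: "snd l < \<beta>" "ereal \<beta> < q (fst l)"
        using ereal_dense2 by (metis less_ereal.simps(1) not_le)
      have "\<forall>\<^sub>F n in sequentially. snd (u n) < \<beta>"
        using order_tendstoD(2)[OF lim(2) \<beta>(1)] .
      \<comment> \<open>The level \<open>\<beta>\<close> may exceed \<open>M\<close>; the minimum
        keeps it where \<open>top\<close> applies.\<close>
      then have "\<forall>\<^sub>F n in sequentially. snd (u n) \<le> min \<beta> M"
        by eventually_elim (use u(4) in auto)
      from level[OF _ this] have "q (fst l) \<le> ereal (min \<beta> M)" by simp
      also have "\<dots> \<le> ereal \<beta>" by simp
      finally show False using \<beta>(2) by simp
    qed
    ultimately show "l \<in> ?K" by (simp add: case_prod_beta)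
  qed
  ultimately show ?thesis by (simp only: compact_eq_bounded_closed)
qed

text \<open>For \<open>z\<close> near \<open>r xb + vb\<close>, minimize
  \<open>q + r / 2 |.|^2 - <z, .>\<close> over a small ball. The subgradient inequality at
  \<open>xb\<close> keeps the minimizer \<open>x\<close> close to \<open>xb\<close>, hence inside
  the ball, and minimality makes \<open>z - r x\<close> a proximal subgradient. These minimizers are
  the values of \<open>P\<close>.\<close>

lemma prox_regular_chart:
  assumes prox: "prox_regular q xb vb" and cont: "subdiff_continuous q xb vb"
  obtains \<rho> U W Z P where "prox_chart q \<rho> U W Z P" "(xb, vb) \<in> W" "(\<rho> + 1) *\<^sub>R xb + vb \<in> Z"
proof -
  obtain \<epsilon> \<rho> where e: "\<epsilon> > 0" and rho: "\<rho> \<ge> 0"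
    and ineq: "\<And>x' x v. x' \<in> cball xb \<epsilon> \<Longrightarrow> x \<in> cball xb \<epsilon> \<Longrightarrow> \<bar>q x - q xb\<bar> \<le> ereal \<epsilon> \<Longrightarrow>
        v \<in> subdiff q x \<inter> cball vb \<epsilon> \<Longrightarrow>
        q x + ereal (inner v (x' - x) - \<rho> / 2 * (norm (x' - x))\<^sup>2) \<le> q x'"
    using prox unfolding prox_regular_def by blast
  obtain \<epsilon>1 where e1: "\<epsilon>1 > 0"
    and lsc: "\<And>\<alpha>. ereal \<alpha> \<le> q xb + ereal \<epsilon>1 \<Longrightarrow> closed {y \<in> cball xb \<epsilon>1. q y \<le> ereal \<alpha>}"
    using prox unfolding prox_regular_def locally_lsc_def by blast
  have vb: "vb \<in> subdiff q xb" using prox by (simp add: prox_regular_def)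
  then obtain \<mu> where \<mu>: "q xb = ereal \<mu>" by (auto simp: subdiff_def)
  obtain \<eta> where eta: "\<eta> > 0" and near: "\<And>x v. (x, v) \<in> gph (subdiff q) \<Longrightarrow> dist (x, v) (xb, vb) < \<eta> \<Longrightarrow>
      \<bar>q x - q xb\<bar> \<le> ereal \<epsilon>"
    using subgradient_values_near[OF cont e] by blast
  define r where "r = \<rho> + 1"
  \<comment> \<open>The third bound keeps the gain from the linear term over the ball at most
    \<open>\<epsilon>1\<close>, so that points above the cap \<open>?M\<close> never beat
    \<open>xb\<close>.\<close>
  define e0 where "e0 = min (min \<epsilon> \<epsilon>1) (\<epsilon>1 / (norm vb + 1))"
  have e0: "e0 > 0" "e0 \<le> \<epsilon>" "e0 \<le> \<epsilon>1"
    using e e1 by (auto simp: e0_def add_nonneg_pos)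
  have e0': "(norm vb + 1) * e0 \<le> \<epsilon>1"
  proof -
    have "e0 \<le> \<epsilon>1 / (norm vb + 1)" by (simp add: e0_def)
    then show ?thesis by (simp add: pos_le_divide_eq add_nonneg_pos mult.commute)
  qed
  define W where "W = ball (xb, vb) (min \<eta> (min \<epsilon> e0))"
  define zb where "zb = r *\<^sub>R xb + vb"
  \<comment> \<open>For \<open>z\<close> within \<open>\<delta>\<close> of \<open>zb\<close>,
    \<open>x\<close> moves by less than \<open>2 * \<delta>\<close> and the subgradient by less than
    \<open>\<delta> + 2 * r * \<delta>\<close>; the sum must fit into the radius of
    \<open>W\<close>. The bound 1 gives
    \<open>norm (z - r *\<^sub>R xb) \<le> norm vb + 1\<close>.\<close>
  define \<delta> where "\<delta> = min 1 (min \<eta> (min \<epsilon> e0) / (3 + 2 * r))"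
  have r: "r \<ge> 1" using rho by (simp add: r_def)
  have delta: "\<delta> > 0" using eta e e0 r by (simp add: \<delta>_def)
  have delta': "\<delta> \<le> 1" "(3 + 2 * r) * \<delta> \<le> min \<eta> (min \<epsilon> e0)"
  proof -
    have "\<delta> \<le> min \<eta> (min \<epsilon> e0) / (3 + 2 * r)" unfolding \<delta>_def by (rule min.cobounded2)
    then show "(3 + 2 * r) * \<delta> \<le> min \<eta> (min \<epsilon> e0)"
      using r by (simp add: pos_le_divide_eq mult.commute)
  qed (simp add: \<delta>_def)
  have W_near: "dist x xb < min \<eta> (min \<epsilon> e0)" "dist v vb < min \<eta> (min \<epsilon> e0)" if "(x, v) \<in> W" for x v
    using that dist_fst_le[of "(x, v)" "(xb, vb)"] dist_snd_le[of "(x, v)" "(xb, vb)"]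
    unfolding W_def mem_ball by (simp_all add: dist_commute)
  have lower: "ereal (\<mu> + (inner vb (y - xb) - \<rho> / 2 * (norm (y - xb))\<^sup>2)) \<le> q y" if "y \<in> cball xb e0" for y
    using ineq[of y xb vb] that e e0 vb \<mu> by simp
  have ex: "\<exists>x. (x, z - r *\<^sub>R x) \<in> gph (subdiff q) \<inter> W" if z: "z \<in> ball zb \<delta>" for z
  proof -
    let ?M = "\<mu> + \<epsilon>1"
    \<comment> \<open>A lower bound for all heights over the ball, from the subgradient inequality
      at \<open>(xb, vb)\<close>; truncating at \<open>m\<close> removes no epigraph point.\<close>
    define m where "m = \<mu> - norm vb * e0 - \<rho> / 2 * e0\<^sup>2"
    let ?K = "{(y, \<alpha>). y \<in> cball xb e0 \<and> q y \<le> ereal \<alpha> \<and> m \<le> \<alpha> \<and> \<alpha> \<le> ?M}"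
    have m: "m \<le> \<beta>" if y: "y \<in> cball xb e0" and "q y \<le> ereal \<beta>" for y \<beta>
    proof -
      have n: "norm (y - xb) \<le> e0" using y by (simp add: dist_norm norm_minus_commute)
      have "\<bar>inner vb (y - xb)\<bar> \<le> norm vb * norm (y - xb)" by (rule Cauchy_Schwarz_ineq2)
      also have "\<dots> \<le> norm vb * e0" using n by (rule mult_left_mono) simp
      finally have "- (norm vb * e0) \<le> inner vb (y - xb)" by simp
      moreover have "\<rho> / 2 * (norm (y - xb))\<^sup>2 \<le> \<rho> / 2 * e0\<^sup>2"
        using n rho by (intro mult_left_mono power_mono) auto
      moreover have "ereal (\<mu> + (inner vb (y - xb) - \<rho> / 2 * (norm (y - xb))\<^sup>2)) \<le> ereal \<beta>"
        using lower[OF y] that(2) by (rule order_trans)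
      ultimately show ?thesis by (simp add: m_def)
    qed
    have "closed {y \<in> cball xb e0. q y \<le> ereal \<alpha>}" if "ereal \<alpha> \<le> ereal ?M" for \<alpha>
    proof -
      have "{y \<in> cball xb e0. q y \<le> ereal \<alpha>} = cball xb e0 \<inter> {y \<in> cball xb \<epsilon>1. q y \<le> ereal \<alpha>}"
        using e0(3) by auto
      then show ?thesis using lsc[of \<alpha>] that by (simp add: \<mu> closed_Int)
    qed
    then have "compact ?K" by (rule compact_truncated_epi)
    moreover have xbK: "(xb, \<mu>) \<in> ?K" using e0 e1 \<mu> m[of xb \<mu>] by simp
    moreover have "continuous_on ?K (\<lambda>u. snd u + r / 2 * (norm (fst u))\<^sup>2 - inner z (fst u))"
      by (intro continuous_intros)
    ultimately obtain u where u: "u \<in> ?K" and u_min: "\<And>w. w \<in> ?K \<Longrightarrow>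
        snd u + r / 2 * (norm (fst u))\<^sup>2 - inner z (fst u) \<le> snd w + r / 2 * (norm (fst w))\<^sup>2 - inner z (fst w)"
      using continuous_attains_inf[of ?K "\<lambda>u. snd u + r / 2 * (norm (fst u))\<^sup>2 - inner z (fst u)"] by blast
    obtain x \<alpha> where ux: "u = (x, \<alpha>)" by (cases u)
    have x: "x \<in> cball xb e0" "q x \<le> ereal \<alpha>" using u ux by auto
    have min_K: "\<alpha> + r / 2 * (norm x)\<^sup>2 - inner z x \<le> \<beta> + r / 2 * (norm y)\<^sup>2 - inner z y"
      if "(y, \<beta>) \<in> ?K" for y \<beta>
      using u_min[OF that] by (simp add: ux)
    have zn: "norm (z - zb) < \<delta>" using z by (simp add: dist_norm norm_minus_commute)
    have minimal: "\<alpha> + (inner (z - r *\<^sub>R x) (y - x) - r / 2 * (norm (y - x))\<^sup>2) \<le> \<beta>"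
      if y: "y \<in> cball xb e0" "q y \<le> ereal \<beta>" for y \<beta>
    proof -
      have "\<alpha> + r / 2 * (norm x)\<^sup>2 - inner z x \<le> \<beta> + r / 2 * (norm y)\<^sup>2 - inner z y"
      proof (cases "\<beta> \<le> ?M")
        case True
        then show ?thesis using y m[OF y] by (intro min_K) auto
      next
        case False
        have "norm (z - r *\<^sub>R xb) \<le> norm (z - zb) + norm vb"
          using norm_triangle_ineq[of "z - zb" vb] by (simp add: zb_def algebra_simps)
        then have zr: "norm (z - r *\<^sub>R xb) \<le> norm vb + 1" using zn delta'(1) by linarith
        have "inner (z - r *\<^sub>R xb) (y - xb) \<le> norm (z - r *\<^sub>R xb) * norm (y - xb)"
          by (rule norm_cauchy_schwarz)
        also have "\<dots> \<le> (norm vb + 1) * e0"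
          using y(1) zr by (intro mult_mono) (auto simp: dist_norm norm_minus_commute)
        finally have *: "inner (z - r *\<^sub>R xb) (y - xb) \<le> \<epsilon>1" using e0' by linarith
        have "\<alpha> + r / 2 * (norm x)\<^sup>2 - inner z x \<le> \<mu> + r / 2 * (norm xb)\<^sup>2 - inner z xb"
          by (rule min_K[OF xbK])
        also have "\<dots> = \<mu> + r / 2 * (norm y)\<^sup>2 - inner z y + inner (z - r *\<^sub>R xb) (y - xb) - r / 2 * (norm (y - xb))\<^sup>2"
          by (simp add: power2_norm_eq_inner inner_diff inner_commute field_simps)
        also have "\<dots> \<le> \<mu> + r / 2 * (norm y)\<^sup>2 - inner z y + \<epsilon>1"
        proof -
          have "0 \<le> r / 2 * (norm (y - xb))\<^sup>2" using r by simp
          then show ?thesis using * by linarith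
        qed
        finally show ?thesis using False by linarith
      qed
      then show ?thesis
        by (simp add: power2_norm_eq_inner inner_diff inner_commute field_simps)
    qed
    \<comment> \<open>The minimizing pair lies on the graph: \<open>minimal\<close> at
      \<open>y = x\<close> excludes any lower height.\<close>
    have "ereal \<alpha> \<le> q x"
    proof (rule ereal_le_real)
      fix \<beta> assume "q x \<le> ereal \<beta>"
      then show "ereal \<alpha> \<le> ereal \<beta>" using minimal[OF x(1), of \<beta>] by simp
    qed
    then have qx: "q x = ereal \<alpha>" using x(2) by (rule antisym[rotated])
    define d where "d = x - xb"
    \<comment> \<open>Adding the subgradient inequality at \<open>xb\<close> to minimality against
      \<open>xb\<close> leaves \<open>1 / 2 * (norm d)^2\<close> on the left, since
      \<open>r - \<rho> = 1\<close>.\<close>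
    have "norm d \<le> 2 * norm (z - zb)"
    proof -
      have "\<mu> + (inner vb (x - xb) - \<rho> / 2 * (norm (x - xb))\<^sup>2) \<le> \<alpha>"
        using lower[OF x(1)] qx by simp
      moreover have "\<alpha> + r / 2 * (norm x)\<^sup>2 - inner z x \<le> \<mu> + r / 2 * (norm xb)\<^sup>2 - inner z xb"
        by (rule min_K[OF xbK])
      ultimately have "1 / 2 * (norm d)\<^sup>2 \<le> inner (z - zb) d"
        by (simp add: d_def zb_def r_def power2_norm_eq_inner inner_diff inner_add inner_commute field_simps)
      also have "\<dots> \<le> norm (z - zb) * norm d" by (rule norm_cauchy_schwarz)
      finally have "norm d * norm d \<le> (2 * norm (z - zb)) * norm d" by (simp add: power2_eq_square)
      then show ?thesis by (cases "norm d = 0") auto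
    qed
    then have d: "norm d < 2 * \<delta>" using zn by linarith
    have "norm (z - r *\<^sub>R x - vb) \<le> norm (z - zb) + norm (r *\<^sub>R d)"
      using norm_triangle_ineq4[of "z - zb" "r *\<^sub>R d"] by (simp add: d_def zb_def algebra_simps)
    also have "\<dots> < \<delta> + r * (2 * \<delta>)"
      using zn d r by (intro add_strict_mono) auto
    finally have "norm (x - xb) + norm (z - r *\<^sub>R x - vb) < (3 + 2 * r) * \<delta>"
      using d by (simp add: d_def algebra_simps)
    then have "norm (x - xb, z - r *\<^sub>R x - vb) < (3 + 2 * r) * \<delta>"
      by (rule order_le_less_trans[OF norm_Pair_le])
    then have "norm (x - xb, z - r *\<^sub>R x - vb) < min \<eta> (min \<epsilon> e0)"
      using delta'(2) by (rule order_less_le_trans)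
    then have xW: "(x, z - r *\<^sub>R x) \<in> W"
      unfolding W_def mem_ball dist_commute[of "(xb, vb)"] by (simp add: dist_norm)
    have "z - r *\<^sub>R x \<in> subdiff q x"
    proof (rule proximal_subgradient[where U = "ball xb e0" and c = "r / 2"])
      show "x \<in> ball xb e0" using W_near(1)[OF xW] by (simp add: dist_commute)
      fix y assume y: "y \<in> ball xb e0"
      show "q x + ereal (inner (z - r *\<^sub>R x) (y - x) - r / 2 * (norm (y - x))\<^sup>2) \<le> q y"
        unfolding qx
      proof (rule ereal_le_real)
        fix \<beta> assume "q y \<le> ereal \<beta>"
        then show "ereal \<alpha> + ereal (inner (z - r *\<^sub>R x) (y - x) - r / 2 * (norm (y - x))\<^sup>2) \<le> ereal \<beta>"
          using minimal[of y \<beta>] y by simp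
      qed
    qed (use qx in auto)
    then show ?thesis using xW by (auto simp: gph_def)
  qed
  then obtain P where P: "\<And>z. z \<in> ball zb \<delta> \<Longrightarrow> (P z, z - r *\<^sub>R P z) \<in> gph (subdiff q) \<inter> W"
    by metis
  have "prox_chart q \<rho> (ball xb e0) W (ball zb \<delta>) P"
  proof
    show "x \<in> ball xb e0" if "(x, v) \<in> W" for x v
      using W_near[OF that] by (simp add: dist_commute)
    show "q x + ereal (inner v (y - x) - \<rho> / 2 * (norm (y - x))\<^sup>2) \<le> q y"
      if xv: "(x, v) \<in> gph (subdiff q) \<inter> W" and y: "y \<in> ball xb e0" for x v y
    proof (rule ineq)
      show "y \<in> cball xb \<epsilon>" "x \<in> cball xb \<epsilon>" "v \<in> subdiff q x \<inter> cball vb \<epsilon>"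
        using W_near[of x v] xv y e0(2) by (auto simp: dist_commute gph_def)
      show "\<bar>q x - q xb\<bar> \<le> ereal \<epsilon>"
        using near[of x v] xv by (simp add: W_def dist_commute)
    qed
    show "(P z, z - (\<rho> + 1) *\<^sub>R P z) \<in> gph (subdiff q) \<inter> W" if "z \<in> ball zb \<delta>" for z
      using P[OF that] by (simp add: r_def)
  qed (use rho in \<open>auto simp: W_def\<close>)
  moreover have "(xb, vb) \<in> W" using eta e e0 by (simp add: W_def)
  moreover have "(\<rho> + 1) *\<^sub>R xb + vb \<in> ball zb \<delta>" using delta by (simp add: zb_def r_def)
  ultimately show thesis using that by blast
qed

section \<open>Limits of tangent spaces and of second subderivatives\<close>

context prox_chart
begin

text \<open>Within the chart both regularity notions amount to differentiability of \<open>P\<close>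
  at the same argument, and a single operator describes the tangent cone and the second
  subderivative.\<close>

lemma smooth_or_gtd:
  assumes xW: "(x, v) \<in> W" and z: "r *\<^sub>R x + v \<in> Z"
    and reg: "(x, v) \<in> smooth_points (subdiff q) \<or> generalized_twice_differentiable q x v"
  obtains A where "firm_selfadjoint A" "(x, v) \<in> smooth_points (subdiff q)"
    "tangent_cone (gph (subdiff q)) (x, v) = qgraph r A"
    "generalized_twice_differentiable q x v" "second_subderiv q x v = qform r A"
proof -
  have gph: "(x, v) \<in> gph (subdiff q) \<inter> W"
    using xW reg by (auto simp: smooth_points_def generalized_twice_differentiable_def gph_def)
  obtain A where A: "chart_deriv (r *\<^sub>R x + v) A"
    using reg chart_deriv_of_tangent_cone[OF gph z] chart_deriv_of_gtd[OF gph z refl]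
    by (auto simp: smooth_points_def)
  have T: "tangent_cone (gph (subdiff q)) (x, v) = qgraph r A"
    by (rule tangent_cone_eq_qgraph[OF gph z A])
  then have "(x, v) \<in> smooth_points (subdiff q)"
    using gph qgraph_in_Zspaces by (auto simp: smooth_points_def)
  then show thesis
    using that chart_deriv_firm_selfadjoint[OF z A] T chart_deriv_gtd[OF gph z refl A] by blast
qed

lemma eventually_in_chart:
  assumes "(xb, vb) \<in> W" "r *\<^sub>R xb + vb \<in> Z" "p \<longlonglongrightarrow> (xb, vb)"
  shows "\<forall>\<^sub>F k in sequentially. p k \<in> W \<and> r *\<^sub>R fst (p k) + snd (p k) \<in> Z"
proof (rule eventually_conj)
  show "\<forall>\<^sub>F k in sequentially. p k \<in> W"
    using assms(1,3) open_W topological_tendstoD by blast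
  have "(\<lambda>k. r *\<^sub>R fst (p k) + snd (p k)) \<longlonglongrightarrow> r *\<^sub>R fst (xb, vb) + snd (xb, vb)"
    by (intro tendsto_intros assms(3))
  then show "\<forall>\<^sub>F k in sequentially. r *\<^sub>R fst (p k) + snd (p k) \<in> Z"
    using open_Z assms(2) topological_tendstoD by fastforce
qed

text \<open>Near the reference pair each tangent space at a smooth point is some
  \<open>qgraph r A\<close> and equals its adjoint, so the two distance sequences eventually
  coincide.\<close>

lemma adjoint_subspace_deriv_eq:
  assumes xb: "(xb, vb) \<in> W" "r *\<^sub>R xb + vb \<in> Z"
  shows "adjoint_subspace_deriv (subdiff q) xb vb = subspace_deriv (subdiff q) xb vb"
proof -
  have "(\<lambda>k. dist_Z L (adjoint_subspace (tangent_cone (gph (subdiff q)) (p k)))) \<longlonglongrightarrow> 0 \<longleftrightarrow>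
      (\<lambda>k. dist_Z L (tangent_cone (gph (subdiff q)) (p k))) \<longlonglongrightarrow> 0"
    if p: "\<forall>k. p k \<in> smooth_points (subdiff q)" "p \<longlonglongrightarrow> (xb, vb)" for L p
  proof (rule tendsto_cong)
    show "\<forall>\<^sub>F k in sequentially. dist_Z L (adjoint_subspace (tangent_cone (gph (subdiff q)) (p k))) =
        dist_Z L (tangent_cone (gph (subdiff q)) (p k))"
      using eventually_in_chart[OF xb p(2)]
    proof eventually_elim
      case (elim k)
      obtain x v where xv: "p k = (x, v)" by (cases "p k")
      obtain A where "firm_selfadjoint A" "tangent_cone (gph (subdiff q)) (x, v) = qgraph r A"
        using smooth_or_gtd[of x v] elim p(1) xv by (metis fst_conv snd_conv)
      then show ?case by (simp add: xv adjoint_qgraph)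
    qed
  qed
  then show ?thesis
    unfolding adjoint_subspace_deriv_def subspace_deriv_def by blast
qed

text \<open>
  In both inclusions the operators \<open>A k\<close> attached to the approximating points range in a compact
  set, so along a subsequence they converge, and with them both the tangent spaces and the second
  subderivatives; the given limit must then be the one induced by the limit operator.
\<close>

lemma subspace_deriv_eq_quad_bundle:
  assumes xb: "(xb, vb) \<in> W" "r *\<^sub>R xb + vb \<in> Z"
  shows "subspace_deriv (subdiff q) xb vb =
    {gph (subdiff (\<lambda>w. ereal (1 / 2) * \<phi> w)) | \<phi>. \<phi> \<in> quad_bundle q xb vb}"
proof (intro set_eqI iffI)
  let ?T = "tangent_cone (gph (subdiff q))"
  \<comment> \<open>The chart describes only points near the reference pair, so approximating
    sequences are started at an index \<open>K\<close>.\<close>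
  have shift: "\<exists>K. \<forall>k. p (k + K) \<in> W \<and> r *\<^sub>R fst (p (k + K)) + snd (p (k + K)) \<in> Z"
    if "p \<longlonglongrightarrow> (xb, vb)" for p
    using eventually_in_chart[OF xb that] unfolding eventually_sequentially by (metis le_add2)
  {
    fix L assume "L \<in> subspace_deriv (subdiff q) xb vb"
    then obtain p where L: "L \<in> Zspaces" and p: "\<And>k. p k \<in> smooth_points (subdiff q)" "p \<longlonglongrightarrow> (xb, vb)"
      and dist: "(\<lambda>k. dist_Z L (?T (p k))) \<longlonglongrightarrow> 0"
      unfolding subspace_deriv_def by blast
    obtain K where K: "\<And>k. p (k + K) \<in> W \<and> r *\<^sub>R fst (p (k + K)) + snd (p (k + K)) \<in> Z"
      using shift[OF p(2)] by blast
    have "\<exists>A. firm_selfadjoint A \<and> ?T (p (k + K)) = qgraph r A \<and>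
        generalized_twice_differentiable q (fst (p (k + K))) (snd (p (k + K))) \<and>
        second_subderiv q (fst (p (k + K))) (snd (p (k + K))) = qform r A" for k
      using smooth_or_gtd[of "fst (p (k + K))" "snd (p (k + K))"] K[of k] p(1)[of "k + K"]
      by (metis prod.collapse)
    then obtain A where A: "\<And>k. firm_selfadjoint (A k)" "\<And>k. ?T (p (k + K)) = qgraph r (A k)"
      "\<And>k. generalized_twice_differentiable q (fst (p (k + K))) (snd (p (k + K)))"
      "\<And>k. second_subderiv q (fst (p (k + K))) (snd (p (k + K))) = qform r (A k)"
      by metis
    obtain B s where s: "strict_mono s" "(\<lambda>k. A (s k)) \<longlonglongrightarrow> B" and B: "firm_selfadjoint B"
      using compact_firm_selfadjoint[of A] A(1) by blast
    have sub: "filterlim (\<lambda>k. s k + K) sequentially sequentially"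
      using filterlim_subseq[OF s(1)] by (rule filterlim_compose[OF filterlim_add_const_nat_at_top])
    have "L = qgraph r B"
    proof (rule dist_Z_limit_unique)
      show "(\<lambda>k. dist_Z L (qgraph r (A (s k)))) \<longlonglongrightarrow> 0"
        using filterlim_compose[OF dist sub] by (simp add: A(2))
      show "(\<lambda>k. dist_Z (qgraph r B) (qgraph r (A (s k)))) \<longlonglongrightarrow> 0"
        by (rule dist_Z_qgraph_tendsto[OF s(2)])
    qed (use L subspace_qgraph in \<open>auto simp: Zspaces_def\<close>)
    then have "L = gph (subdiff (\<lambda>w. ereal (1 / 2) * qform r B w))"
      by (simp only: gph_half_qform[OF B])
    moreover have "qform r B \<in> quad_bundle q xb vb"
      unfolding quad_bundle_def
    proof (intro CollectI conjI exI allI)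
      show "generalized_twice_differentiable q (fst (p (s k + K))) (snd (p (s k + K)))" for k
        by (rule A(3))
      show "(\<lambda>k. (fst (p (s k + K)), snd (p (s k + K)))) \<longlonglongrightarrow> (xb, vb)"
        using filterlim_compose[OF p(2) sub] by simp
      show "epi_converges (\<lambda>k. second_subderiv q (fst (p (s k + K))) (snd (p (s k + K)))) (qform r B) sequentially"
        unfolding A(4) using B A(1) s(2) by (rule qform_epi_converges)
    qed (rule generalized_quadratic_form_qform[OF B])
    ultimately show "L \<in> {gph (subdiff (\<lambda>w. ereal (1 / 2) * \<phi> w)) | \<phi>. \<phi> \<in> quad_bundle q xb vb}"
      by blast
  }
  fix L assume "L \<in> {gph (subdiff (\<lambda>w. ereal (1 / 2) * \<phi> w)) | \<phi>. \<phi> \<in> quad_bundle q xb vb}"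
  then obtain \<phi> xs vs where L: "L = gph (subdiff (\<lambda>w. ereal (1 / 2) * \<phi> w))"
    and gtd: "\<And>k. generalized_twice_differentiable q (xs k) (vs k)"
    and p: "(\<lambda>k. (xs k, vs k)) \<longlonglongrightarrow> (xb, vb)"
    and conv: "epi_converges (\<lambda>k. second_subderiv q (xs k) (vs k)) \<phi> sequentially"
    unfolding quad_bundle_def by blast
  obtain K where K: "\<And>k. (xs (k + K), vs (k + K)) \<in> W \<and> r *\<^sub>R xs (k + K) + vs (k + K) \<in> Z"
    using shift[OF p] by auto
  have "\<exists>A. firm_selfadjoint A \<and> (xs (k + K), vs (k + K)) \<in> smooth_points (subdiff q) \<and>
      ?T (xs (k + K), vs (k + K)) = qgraph r A \<and>
      second_subderiv q (xs (k + K)) (vs (k + K)) = qform r A" for k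
    using smooth_or_gtd[of "xs (k + K)" "vs (k + K)"] K[of k] gtd[of "k + K"] by metis
  then obtain A where A: "\<And>k. firm_selfadjoint (A k)"
    "\<And>k. (xs (k + K), vs (k + K)) \<in> smooth_points (subdiff q)"
    "\<And>k. ?T (xs (k + K), vs (k + K)) = qgraph r (A k)"
    "\<And>k. second_subderiv q (xs (k + K)) (vs (k + K)) = qform r (A k)"
    by metis
  obtain B s where s: "strict_mono s" "(\<lambda>k. A (s k)) \<longlonglongrightarrow> B" and B: "firm_selfadjoint B"
    using compact_firm_selfadjoint[of A] A(1) by blast
  have sub: "filterlim (\<lambda>k. s k + K) sequentially sequentially"
    using filterlim_subseq[OF s(1)] by (rule filterlim_compose[OF filterlim_add_const_nat_at_top])
  have "epi_converges (\<lambda>k. qform r (A (s k))) \<phi> sequentially"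
    using epi_converges_compose[OF conv sub sequentially_bot] by (simp add: A(4))
  then have "\<phi> = qform r B"
    using qform_epi_converges[OF B A(1) s(2)] by (rule epi_converges_unique)
  then have L': "L = qgraph r B"
    by (simp only: L gph_half_qform[OF B])
  show "L \<in> subspace_deriv (subdiff q) xb vb"
    unfolding subspace_deriv_def L'
  proof (intro CollectI conjI exI allI)
    show "(xs (s k + K), vs (s k + K)) \<in> smooth_points (subdiff q)" for k by (rule A(2))
    show "(\<lambda>k. (xs (s k + K), vs (s k + K))) \<longlonglongrightarrow> (xb, vb)"
      using filterlim_compose[OF p sub] .
    show "(\<lambda>k. dist_Z (qgraph r B) (?T (xs (s k + K), vs (s k + K)))) \<longlonglongrightarrow> 0"
      unfolding A(3) by (rule dist_Z_qgraph_tendsto[OF s(2)])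
  qed (rule qgraph_in_Zspaces)
qed

end

theorem proposition3p33:
  fixes q :: "real ^ 'n \<Rightarrow> ereal" and xb vb :: "real ^ 'n"
  assumes "prox_regular q xb vb"
    and "\<forall>\<^sub>F (x, v) in nhds (xb, vb). (x, v) \<in> gph (subdiff q) \<longrightarrow> subdiff_continuous q x v"
  shows "adjoint_subspace_deriv (subdiff q) xb vb = subspace_deriv (subdiff q) xb vb \<and>
         subspace_deriv (subdiff q) xb vb =
           {gph (subdiff (\<lambda>w. ereal (1 / 2) * \<phi> w)) | \<phi>. \<phi> \<in> quad_bundle q xb vb}"
proof -
  have "(xb, vb) \<in> gph (subdiff q)"
    using assms(1) by (simp add: prox_regular_def gph_def)
  then have "subdiff_continuous q xb vb"
    using eventually_nhds_x_imp_x[OF assms(2)] by simp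
  with assms(1) obtain \<rho> U W Z P where "prox_chart q \<rho> U W Z P"
    and xb: "(xb, vb) \<in> W" "(\<rho> + 1) *\<^sub>R xb + vb \<in> Z"
    by (rule prox_regular_chart)
  then interpret prox_chart q \<rho> U W Z P by simp
  show ?thesis
    using adjoint_subspace_deriv_eq[OF xb] subspace_deriv_eq_quad_bundle[OF xb] by blast
qed

end
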